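(* Let $(\mathcal{A},\sigma)$ be an automorphic multivariable $C^*$-dynamical system, $\sigma=(\sigma_1,\dots,\sigma_n)$, and assume that the crossed product $C^*$-algebra $\mathcal{A}\times_\sigma\mathbb{F}_n$ is residually finite dimensional. Then every approximately local derivation on the semicrossed product $\mathcal{A}\times_\sigma\mathbb{F}_n^+$ is a derivation.
   Context: An automorphic multivariable $C^*$-dynamical system $(\mathcal{A},\sigma)$ is a $C^*$-algebra $\mathcal{A}$ with finitely many $*$-automorphisms $\sigma=(\sigma_1,\dots,\sigma_n)$ of $\mathcal{A}$. $\mathbb{F}_n$ is the free group on $n$ generators and $\mathbb{F}_n^+$ the free (unital) semigroup on $n$ generators. $\mathcal{A}\times_\sigma\mathbb{F}_n$ is the full crossed product by the induced free group action, with implementing unitaries $U_1,\dots,U_n$ satisfying the covariance relations $aU_i=U_i\sigma_i(a)$, $a\in\mathcal{A}$. The semicrossed product $\mathcal{A}\times_\sigma\mathbb{F}_n^+$ is the norm-closed non-selfadjoint subalgebra of $\mathcal{A}\times_\sigma\mathbb{F}_n$ generated by $\mathcal{A}$ and the elements $U_ia$, $a\in\mathcal{A}$, $1\le i\le n$ (for unital $\mathcal{A}$, generated by $\mathcal{A}$ and $U_1,\dots,U_n$). A $C^*$-algebra is residually finite dimensional (RFD) if its finite dimensional $*$-representations separate its points. All linear maps are bounded. A derivation of a Banach algebra $\mathcal{B}$ is a bounded linear map $\delta:\mathcal{B}\to\mathcal{B}$ with $\delta(AB)=\delta(A)B+A\delta(B)$. A bounded linear map $\delta:\mathcal{B}\to\mathcal{B}$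 is an approximately local derivation if for every $A\in\mathcal{B}$ there is a sequence of derivations $\delta_{A,k}$ of $\mathcal{B}$ with $\delta(A)=\lim_k\delta_{A,k}(A)$. *)

theory Defs
  imports
    "HOL-Analysis.Analysis"
    "HOL-Library.Poly_Mapping"
    "Jordan_Normal_Form.Schur_Decomposition"
begin

section \<open>\<open>C\<^sup>*\<close>-algebras\<close>

text \<open>A \<open>C\<^sup>*\<close>-algebra is not assumed to have a unit. The real scalar multiplication inherited from
  the library class is the restriction of the complex one.\<close>

class cstar_algebra = real_normed_algebra + banach +
  fixes scaleC :: "complex \<Rightarrow> 'a \<Rightarrow> 'a"  (infixr \<open>*\<^sub>C\<close> 75)
    and adj :: "'a \<Rightarrow> 'a"
  assumes scaleC_add_right: "c *\<^sub>C (x + y) = c *\<^sub>C x + c *\<^sub>C y"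
    and scaleC_add_left: "(c + d) *\<^sub>C x = c *\<^sub>C x + d *\<^sub>C x"
    and scaleC_scaleC: "c *\<^sub>C d *\<^sub>C x = (c * d) *\<^sub>C x"
    and scaleC_of_real: "complex_of_real r *\<^sub>C x = r *\<^sub>R x"
    and mult_scaleC_left: "(c *\<^sub>C x) * y = c *\<^sub>C (x * y)"
    and mult_scaleC_right: "x * (c *\<^sub>C y) = c *\<^sub>C (x * y)"
    and norm_scaleC: "norm (c *\<^sub>C x) = cmod c * norm x"
    and adj_add: "adj (x + y) = adj x + adj y"
    and adj_scaleC: "adj (c *\<^sub>C x) = cnj c *\<^sub>C adj x"
    and adj_mult: "adj (x * y) = adj y * adj x"
    and adj_adj: "adj (adj x) = x"
    and norm_adj_mult: "norm (adj x * x) = (norm x)\<^sup>2"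

definition star_automorphism :: "('a::cstar_algebra \<Rightarrow> 'a) \<Rightarrow> bool" where
  "star_automorphism \<phi> \<longleftrightarrow> bij \<phi> \<and>
     (\<forall>x y. \<phi> (x + y) = \<phi> x + \<phi> y) \<and> (\<forall>c x. \<phi> (c *\<^sub>C x) = c *\<^sub>C \<phi> x) \<and>
     (\<forall>x y. \<phi> (x * y) = \<phi> x * \<phi> y) \<and> (\<forall>x. \<phi> (adj x) = adj (\<phi> x))"

definition matrix_star_rep :: "nat \<Rightarrow> ('c::cstar_algebra \<Rightarrow> complex mat) \<Rightarrow> bool" where
  "matrix_star_rep k \<rho> \<longleftrightarrow> (\<forall>x. \<rho> x \<in> carrier_mat k k) \<and>
     (\<forall>x y. \<rho> (x + y) = \<rho> x + \<rho> y) \<and> (\<forall>c x. \<rho> (c *\<^sub>C x) = c \<cdot>\<^sub>m \<rho> x) \<and>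
     (\<forall>x y. \<rho> (x * y) = \<rho> x * \<rho> y) \<and> (\<forall>x. \<rho> (adj x) = mat_adjoint (\<rho> x))"

definition residually_finite_dimensional :: "'c::cstar_algebra itself \<Rightarrow> bool" where
  "residually_finite_dimensional _ \<longleftrightarrow>
     (\<forall>x y :: 'c. x \<noteq> y \<longrightarrow> (\<exists>k \<rho>. matrix_star_rep k \<rho> \<and> \<rho> x \<noteq> \<rho> y))"


section \<open>Free groups\<close>

text \<open>The free group on the letters \<open>'n\<close> is realized by the reduced words; the letter \<open>(i, True)\<close> stands
  for the generator \<open>i\<close> and \<open>(i, False)\<close> for its inverse.\<close>

fun flip :: "'n \<times> bool \<Rightarrow> 'n \<times> bool" where
  "flip (i, b) = (i, \<not> b)"

definition reduced :: "('n \<times> bool) list \<Rightarrow> bool" where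
  "reduced = successively (\<lambda>x y. y \<noteq> flip x)"

fun push :: "'n \<times> bool \<Rightarrow> ('n \<times> bool) list \<Rightarrow> ('n \<times> bool) list" where
  "push x [] = [x]"
| "push x (y # w) = (if y = flip x then w else x # y # w)"

lemma flip_flip [simp]: "flip (flip x) = x"
  by (cases x) simp

lemma reduced_Nil [simp]: "reduced []"
  by (simp add: reduced_def)

lemma reduced_tl: "reduced (x # w) \<Longrightarrow> reduced w"
  by (simp add: reduced_def successively_Cons) (metis successively.simps(1))

lemma reduced_push: "reduced w \<Longrightarrow> reduced (push x w)"
  by (cases w) (auto simp: reduced_def successively_Cons)

lemma reduced_foldr_push: "reduced v \<Longrightarrow> reduced (foldr push u v)"
  by (induction u) (auto intro: reduced_push)

lemma reduced_rev_flip: "reduced w \<Longrightarrow> reduced (rev (map flip w))"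
  unfolding reduced_def successively_rev successively_map
  by (erule successively_mono) (metis flip_flip)

lemma push_push_flip: "reduced w \<Longrightarrow> push x (push (flip x) w) = w"
proof (cases w)
  case (Cons y v)
  assume "reduced w"
  with Cons show ?thesis by (cases v) (auto simp: reduced_def)
qed simp

lemma push_reduced: "reduced (x # w) \<Longrightarrow> push x w = x # w"
  by (cases w) (auto simp: reduced_def)

lemma foldr_push_push:
  "reduced w \<Longrightarrow> foldr push (push x r) w = push x (foldr push r w)"
  by (cases r) (auto simp: push_push_flip reduced_foldr_push)

lemma foldr_push_assoc:
  "reduced w \<Longrightarrow> foldr push (foldr push u v) w = foldr push u (foldr push v w)"
  by (induction u) (auto simp: foldr_push_push)

lemma foldr_push_Nil: "reduced u \<Longrightarrow> foldr push u [] = u"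
proof (induction u)
  case (Cons x u)
  then have "foldr push u [] = u" using reduced_tl by blast
  with Cons.prems show ?case by (simp add: push_reduced del: split_paired_All)
qed simp

lemma foldr_push_rev_flip: "reduced w \<Longrightarrow> foldr push (rev (map flip u)) (foldr push u w) = w"
proof (induction u arbitrary: w)
  case (Cons x u)
  have "push (flip x) (push x (foldr push u w)) = foldr push u w"
    using push_push_flip[of "foldr push u w" "flip x"] Cons.prems
    by (simp add: reduced_foldr_push)
  with Cons show ?case by simp
qed simp

typedef 'n free_group = "{w :: ('n \<times> bool) list. reduced w}"
  morphisms word Abs_free_group
  by (rule exI[of _ "[]"]) simp

setup_lifting type_definition_free_group

instantiation free_group :: (type) monoid_mult
begin

lift_definition one_free_group :: "'n free_group" is "[]"
  by simp

lift_definition times_free_group :: "'n free_group \<Rightarrow> 'n free_group \<Rightarrow> 'n free_group"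
  is "foldr push"
  by (rule reduced_foldr_push)

instance
  by standard (transfer; simp add: foldr_push_assoc foldr_push_Nil)+

end

lift_definition free_inv :: "'n free_group \<Rightarrow> 'n free_group" is "\<lambda>w. rev (map flip w)"
  by (rule reduced_rev_flip)

lemma free_inv_left: "free_inv s * s = 1"
  by transfer (metis foldr_push_Nil foldr_push_rev_flip reduced_Nil)

lift_definition gen :: "'n \<Rightarrow> 'n free_group" is "\<lambda>i. [(i, True)]"
  by (simp add: reduced_def)


section \<open>The full crossed product\<close>

text \<open>The covariance relation \<open>a U\<^sub>i = U\<^sub>i \<sigma>\<^sub>i(a)\<close> says \<open>U\<^sub>i a U\<^sub>i\<^sup>* = \<sigma>\<^sub>i\<^sup>-\<^sup>1(a)\<close>. The action \<open>\<alpha>\<close> of the free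
  group that the unitaries implement by \<open>\<alpha>\<^sub>s(a) = U\<^sub>s a U\<^sub>s\<^sup>*\<close> therefore sends the generator \<open>i\<close>
  to the inverse of \<open>\<sigma>\<^sub>i\<close>.\<close>

definition letter_action :: "('n \<Rightarrow> 'a \<Rightarrow> 'a) \<Rightarrow> 'n \<times> bool \<Rightarrow> 'a \<Rightarrow> 'a" where
  "letter_action \<sigma> x = (if snd x then inv_into UNIV (\<sigma> (fst x)) else \<sigma> (fst x))"

definition action :: "('n \<Rightarrow> 'a \<Rightarrow> 'a) \<Rightarrow> 'n free_group \<Rightarrow> 'a \<Rightarrow> 'a" where
  "action \<sigma> s = foldr (letter_action \<sigma>) (word s)"

text \<open>The convolution \<open>*\<close>-algebra of finitely supported functions from the free group to \<open>'a\<close>;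
  the function \<open>Poly_Mapping.single s a\<close> stands for \<open>a U\<^sub>s\<close>.\<close>

type_synonym ('n, 'a) conv = "'n free_group \<Rightarrow>\<^sub>0 'a"

definition conv_scale :: "complex \<Rightarrow> ('n, 'a::cstar_algebra) conv \<Rightarrow> ('n, 'a) conv" where
  "conv_scale c f = (\<Sum>s\<in>Poly_Mapping.keys f. Poly_Mapping.single s (c *\<^sub>C Poly_Mapping.lookup f s))"

definition conv_mult ::
    "('n \<Rightarrow> 'a \<Rightarrow> 'a) \<Rightarrow> ('n, 'a::cstar_algebra) conv \<Rightarrow> ('n, 'a) conv \<Rightarrow> ('n, 'a) conv" where
  "conv_mult \<sigma> f g = (\<Sum>s\<in>Poly_Mapping.keys f. \<Sum>t\<in>Poly_Mapping.keys g.
     Poly_Mapping.single (s * t) (Poly_Mapping.lookup f s * action \<sigma> s (Poly_Mapping.lookup g t)))"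

definition conv_adj ::
    "('n \<Rightarrow> 'a \<Rightarrow> 'a) \<Rightarrow> ('n, 'a::cstar_algebra) conv \<Rightarrow> ('n, 'a) conv" where
  "conv_adj \<sigma> f = (\<Sum>s\<in>Poly_Mapping.keys f.
     Poly_Mapping.single (free_inv s) (action \<sigma> (free_inv s) (adj (Poly_Mapping.lookup f s))))"

text \<open>The Hilbert space \<open>\<ell>\<^sup>2(I)\<close> for \<open>I\<close> the type \<open>'i\<close>. Operators are total functions, of which only
  the restriction to \<open>\<ell>\<^sup>2(I)\<close> matters.\<close>

definition ell2 :: "('i \<Rightarrow> complex) set" where
  "ell2 = {\<xi>. (\<lambda>i. (cmod (\<xi> i))\<^sup>2) summable_on UNIV}"

definition ell2_norm :: "('i \<Rightarrow> complex) \<Rightarrow> real" where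
  "ell2_norm \<xi> = sqrt (\<Sum>\<^sub>\<infinity>i. (cmod (\<xi> i))\<^sup>2)"

definition ell2_inner :: "('i \<Rightarrow> complex) \<Rightarrow> ('i \<Rightarrow> complex) \<Rightarrow> complex" where
  "ell2_inner \<xi> \<eta> = (\<Sum>\<^sub>\<infinity>i. \<xi> i * cnj (\<eta> i))"

type_synonym 'i operator = "('i \<Rightarrow> complex) \<Rightarrow> 'i \<Rightarrow> complex"

definition bounded_operator :: "'i operator \<Rightarrow> bool" where
  "bounded_operator T \<longleftrightarrow> (\<forall>\<xi>\<in>ell2. T \<xi> \<in> ell2) \<and>
     (\<forall>\<xi>\<in>ell2. \<forall>\<eta>\<in>ell2. T (\<lambda>i. \<xi> i + \<eta> i) = (\<lambda>i. T \<xi> i + T \<eta> i)) \<and>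
     (\<forall>c. \<forall>\<xi>\<in>ell2. T (\<lambda>i. c * \<xi> i) = (\<lambda>i. c * T \<xi> i)) \<and>
     (\<exists>K. \<forall>\<xi>\<in>ell2. ell2_norm (T \<xi>) \<le> K * ell2_norm \<xi>)"

definition unitary_operator :: "'i operator \<Rightarrow> bool" where
  "unitary_operator T \<longleftrightarrow> bounded_operator T \<and> T ` ell2 = ell2 \<and>
     (\<forall>\<xi>\<in>ell2. \<forall>\<eta>\<in>ell2. ell2_inner (T \<xi>) (T \<eta>) = ell2_inner \<xi> \<eta>)"

definition star_representation :: "('a::cstar_algebra \<Rightarrow> 'i operator) \<Rightarrow> bool" where
  "star_representation \<pi> \<longleftrightarrow> (\<forall>a. bounded_operator (\<pi> a)) \<and>
     (\<forall>a b. \<forall>\<xi>\<in>ell2. \<pi> (a + b) \<xi> = (\<lambda>i. \<pi> a \<xi> i + \<pi> b \<xi> i)) \<and>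
     (\<forall>c a. \<forall>\<xi>\<in>ell2. \<pi> (c *\<^sub>C a) \<xi> = (\<lambda>i. c * \<pi> a \<xi> i)) \<and>
     (\<forall>a b. \<forall>\<xi>\<in>ell2. \<pi> (a * b) \<xi> = \<pi> a (\<pi> b \<xi>)) \<and>
     (\<forall>a. \<forall>\<xi>\<in>ell2. \<forall>\<eta>\<in>ell2. ell2_inner (\<pi> a \<xi>) \<eta> = ell2_inner \<xi> (\<pi> (adj a) \<eta>))"

definition unitary_representation :: "('n free_group \<Rightarrow> 'i operator) \<Rightarrow> bool" where
  "unitary_representation u \<longleftrightarrow> (\<forall>s. unitary_operator (u s)) \<and>
     (\<forall>\<xi>\<in>ell2. u 1 \<xi> = \<xi>) \<and> (\<forall>s t. \<forall>\<xi>\<in>ell2. u (s * t) \<xi> = u s (u t \<xi>))"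

definition covariant_representation ::
    "('n \<Rightarrow> 'a \<Rightarrow> 'a) \<Rightarrow> ('a::cstar_algebra \<Rightarrow> 'i operator) \<Rightarrow> ('n free_group \<Rightarrow> 'i operator) \<Rightarrow> bool" where
  "covariant_representation \<sigma> \<pi> u \<longleftrightarrow> star_representation \<pi> \<and> unitary_representation u \<and>
     (\<forall>a s. \<forall>\<xi>\<in>ell2. u s (\<pi> a \<xi>) = \<pi> (action \<sigma> s a) (u s \<xi>))"

definition integrated_form ::
    "('a::cstar_algebra \<Rightarrow> 'i operator) \<Rightarrow> ('n free_group \<Rightarrow> 'i operator) \<Rightarrow> ('n, 'a) conv \<Rightarrow> 'i operator" where
  "integrated_form \<pi> u f \<xi> = (\<lambda>i. \<Sum>s\<in>Poly_Mapping.keys f. \<pi> (Poly_Mapping.lookup f s) (u s \<xi>) i)"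

text \<open>The universal norm is the supremum of the operator norms of \<open>f\<close> over all covariant
  representations. It suffices to use the Hilbert space \<open>\<ell>\<^sup>2(I)\<close> with \<open>I\<close> the convolution algebra
  itself: a norm over all Hilbert spaces is attained on cyclic representations, a cyclic
  representation space has Hilbert dimension at most the cardinality of \<open>I\<close>, and a covariant pair
  extends to a larger Hilbert space by \<open>\<pi> = 0\<close> and \<open>u = 1\<close> on the orthogonal complement (hence
  \<open>\<pi>\<close> is not required to be nondegenerate). The norms are bounded by \<open>\<Sum>\<^sub>s \<parallel>f(s)\<parallel>\<close>, so the
  supremum exists.\<close>

definition universal_norm :: "('n \<Rightarrow> 'a \<Rightarrow> 'a) \<Rightarrow> ('n, 'a::cstar_algebra) conv \<Rightarrow> real" where
  "universal_norm \<sigma> f =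
     (SUP (\<pi>, u, \<xi>) \<in> {(\<pi> :: 'a \<Rightarrow> ('n, 'a) conv operator, u, \<xi>).
        covariant_representation \<sigma> \<pi> u \<and> \<xi> \<in> ell2 \<and> ell2_norm \<xi> \<le> 1}.
        ell2_norm (integrated_form \<pi> u f \<xi>))"

text \<open>The full crossed product is the completion of the convolution algebra in the universal
  norm. Since it depends on \<open>\<sigma>\<close> it is not a type of its own; instead, a \<open>C\<^sup>*\<close>-algebra \<open>'c\<close>
  together with the canonical map \<open>j\<close> from the convolution algebra is recognized as such a
  completion.\<close>

definition full_crossed_product ::
    "('n \<Rightarrow> 'a \<Rightarrow> 'a) \<Rightarrow> (('n, 'a::cstar_algebra) conv \<Rightarrow> 'c::cstar_algebra) \<Rightarrow> bool" where
  "full_crossed_product \<sigma> j \<longleftrightarrow>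
     (\<forall>f g. j (f + g) = j f + j g) \<and> (\<forall>c f. j (conv_scale c f) = c *\<^sub>C j f) \<and>
     (\<forall>f g. j (conv_mult \<sigma> f g) = j f * j g) \<and> (\<forall>f. j (conv_adj \<sigma> f) = adj (j f)) \<and>
     (\<forall>f. norm (j f) = universal_norm \<sigma> f) \<and> closure (range j) = UNIV"


section \<open>The semicrossed product\<close>

definition complex_subalgebra :: "'c::cstar_algebra set \<Rightarrow> bool" where
  "complex_subalgebra B \<longleftrightarrow> 0 \<in> B \<and> (\<forall>x\<in>B. \<forall>y\<in>B. x + y \<in> B) \<and>
     (\<forall>c. \<forall>x\<in>B. c *\<^sub>C x \<in> B) \<and> (\<forall>x\<in>B. \<forall>y\<in>B. x * y \<in> B)"

definition closed_subalgebra_generated :: "'c::cstar_algebra set \<Rightarrow> 'c set" where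
  "closed_subalgebra_generated S = \<Inter>{B. complex_subalgebra B \<and> closed B \<and> S \<subseteq> B}"

text \<open>As \<open>U\<^sub>i a = \<sigma>\<^sub>i\<^sup>-\<^sup>1(a) U\<^sub>i\<close>, the element \<open>U\<^sub>i a\<close> of the crossed product is the image of the function
  with value \<open>\<sigma>\<^sub>i\<^sup>-\<^sup>1(a)\<close> at the generator \<open>i\<close>.\<close>

definition semicrossed_product ::
    "('n \<Rightarrow> 'a \<Rightarrow> 'a) \<Rightarrow> (('n, 'a::cstar_algebra) conv \<Rightarrow> 'c::cstar_algebra) \<Rightarrow> 'c set" where
  "semicrossed_product \<sigma> j = closed_subalgebra_generated
     (range (\<lambda>a. j (Poly_Mapping.single 1 a)) \<union>
      range (\<lambda>(i, a). j (Poly_Mapping.single (gen i) (inv_into UNIV (\<sigma> i) a))))"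


section \<open>Derivations\<close>

definition bounded_linear_map_on :: "'c::cstar_algebra set \<Rightarrow> ('c \<Rightarrow> 'c) \<Rightarrow> bool" where
  "bounded_linear_map_on B \<delta> \<longleftrightarrow> \<delta> ` B \<subseteq> B \<and>
     (\<forall>x\<in>B. \<forall>y\<in>B. \<delta> (x + y) = \<delta> x + \<delta> y) \<and> (\<forall>c. \<forall>x\<in>B. \<delta> (c *\<^sub>C x) = c *\<^sub>C \<delta> x) \<and>
     (\<exists>K. \<forall>x\<in>B. norm (\<delta> x) \<le> K * norm x)"

definition derivation_on :: "'c::cstar_algebra set \<Rightarrow> ('c \<Rightarrow> 'c) \<Rightarrow> bool" where
  "derivation_on B \<delta> \<longleftrightarrow> bounded_linear_map_on B \<delta> \<and>
     (\<forall>x\<in>B. \<forall>y\<in>B. \<delta> (x * y) = \<delta> x * y + x * \<delta> y)"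

definition approximately_local_derivation_on :: "'c::cstar_algebra set \<Rightarrow> ('c \<Rightarrow> 'c) \<Rightarrow> bool" where
  "approximately_local_derivation_on B \<delta> \<longleftrightarrow> bounded_linear_map_on B \<delta> \<and>
     (\<forall>x\<in>B. \<exists>D :: nat \<Rightarrow> 'c \<Rightarrow> 'c. (\<forall>k. derivation_on B (D k)) \<and> (\<lambda>k. D k x) \<longlonglongrightarrow> \<delta> x)"

end

theory Submission
  imports Defs
begin

text \<open>Let \<open>J\<close> be the kernel of a finite dimensional representation \<open>\<rho>\<close> of the crossed product.
  As \<open>\<rho>\<close> turns the inverse of \<open>U\<^sub>i\<close> into a polynomial in \<open>U\<^sub>i\<close>, the image under \<open>\<rho>\<close> of the algebra
  generated by \<open>a\<close> and \<open>U\<^sub>i a\<close> is a \<open>*\<close>-algebra of matrices, hence semisimple. Sinclair's argument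
  then shows that every derivation of the semicrossed product maps its intersection with \<open>J\<close> into
  \<open>J\<close>, so that an approximately local derivation induces one on a finite dimensional \<open>C\<^sup>*\<close>-algebra.
  Such an algebra is spanned by its idempotents, and on idempotents \<open>p\<close>, \<open>q\<close> locality gives
  \<open>\<delta>(p x q) = \<delta>(p x) q + p \<delta>(x q) - p \<delta>(x) q\<close>; together with \<open>\<delta>(e) = \<delta>(e) e + e \<delta>(e)\<close> for local
  units \<open>e\<close>, this forces the Leibniz rule modulo \<open>J\<close>. The ideals \<open>J\<close> intersect in 0.\<close>

section \<open>Elementary facts on \<open>C\<^sup>*\<close>-algebras\<close>

lemma scaleC_zero_right [simp]: "c *\<^sub>C (0::'a::cstar_algebra) = 0"
  using scaleC_add_right[of c 0 0] by simp

lemma scaleC_zero_left [simp]: "0 *\<^sub>C (x::'a::cstar_algebra) = 0"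
  using scaleC_add_left[of 0 0 x] by simp

lemma scaleC_one [simp]: "1 *\<^sub>C (x::'a::cstar_algebra) = x"
  using scaleC_of_real[of 1 x] by simp

lemma scaleC_minus_left [simp]: "(- c) *\<^sub>C (x::'a::cstar_algebra) = - (c *\<^sub>C x)"
  using scaleC_add_left[of c "- c" x] by (simp add: eq_neg_iff_add_eq_0 add.commute)

lemma scaleC_minus_right [simp]: "c *\<^sub>C (- x :: 'a::cstar_algebra) = - (c *\<^sub>C x)"
  using scaleC_add_right[of c x "- x"] by (simp add: eq_neg_iff_add_eq_0 add.commute)

lemma scaleC_diff_right: "c *\<^sub>C (x - y :: 'a::cstar_algebra) = c *\<^sub>C x - c *\<^sub>C y"
  using scaleC_add_right[of c x "- y"] by simp

lemma scaleC_sum_right: "c *\<^sub>C (\<Sum>i\<in>I. f i :: 'a::cstar_algebra) = (\<Sum>i\<in>I. c *\<^sub>C f i)"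
  by (induction I rule: infinite_finite_induct) (auto simp: scaleC_add_right)

lemma bounded_linear_scaleC: "bounded_linear (\<lambda>x::'a::cstar_algebra. c *\<^sub>C x)"
proof (rule bounded_linear_intro)
  fix x :: 'a and r :: real
  show "c *\<^sub>C (r *\<^sub>R x) = r *\<^sub>R (c *\<^sub>C x)"
    by (simp add: scaleC_of_real[symmetric] scaleC_scaleC mult.commute)
  show "norm (c *\<^sub>C x) \<le> norm x * cmod c"
    by (simp add: norm_scaleC mult.commute)
qed (rule scaleC_add_right)

lemma adj_zero [simp]: "adj (0::'a::cstar_algebra) = 0"
  using adj_add[of "0::'a" 0] by simp

lemma adj_minus [simp]: "adj (- x :: 'a::cstar_algebra) = - adj x"
  using adj_add[of x "- x"] by (simp add: eq_neg_iff_add_eq_0 add.commute)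

lemma adj_diff: "adj (x - y :: 'a::cstar_algebra) = adj x - adj y"
  using adj_add[of x "- y"] by simp

lemma adj_sum: "adj (\<Sum>i\<in>I. f i :: 'a::cstar_algebra) = (\<Sum>i\<in>I. adj (f i))"
  by (induction I rule: infinite_finite_induct) (auto simp: adj_add)

lemma norm_adj [simp]: "norm (adj (x::'a::cstar_algebra)) = norm x"
proof -
  have le: "norm y \<le> norm (adj y)" for y :: 'a
  proof (cases "norm y = 0")
    case False
    have "norm y * norm y \<le> norm (adj y) * norm y"
      using norm_mult_ineq[of "adj y" y] norm_adj_mult[of y] by (simp add: power2_eq_square)
    with False show ?thesis by simp
  qed simp
  show ?thesis
    using le[of x] le[of "adj x"] by (simp add: adj_adj)
qed

text \<open>The element \<open>y\<close> makes \<open>1 - y\<close> an inverse of \<open>1 - x\<close> in the unitization.\<close>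

lemma quasi_inverse_exists:
  fixes x :: "'a::{real_normed_algebra, banach}"
  assumes "norm x < 1"
  shows "\<exists>y. y = y * x - x"
proof -
  have "\<exists>!y. y * x - x = y"
    by (rule banach_fix_type[of "norm x"])
      (use assms norm_mult_ineq[of "_ - _" x] in
        \<open>auto simp: dist_norm left_diff_distrib[symmetric] mult.commute\<close>)
  then show ?thesis by metis
qed

section \<open>The trace of a matrix\<close>

definition mtrace :: "complex mat \<Rightarrow> complex" where
  "mtrace A = (\<Sum>i<dim_row A. A $$ (i, i))"

lemma mtrace_add:
  "A \<in> carrier_mat k k \<Longrightarrow> B \<in> carrier_mat k k \<Longrightarrow> mtrace (A + B) = mtrace A + mtrace B"
  by (auto simp: mtrace_def sum.distrib)

lemma mtrace_mult_comm:
  assumes "A \<in> carrier_mat k k" "B \<in> carrier_mat k k"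
  shows "mtrace (A * B) = mtrace (B * A)"
proof -
  have "mtrace (A * B) = (\<Sum>i<k. \<Sum>j<k. A $$ (i, j) * B $$ (j, i))"
    using assms by (auto simp: mtrace_def scalar_prod_def atLeast0LessThan intro!: sum.cong)
  also have "\<dots> = (\<Sum>j<k. \<Sum>i<k. A $$ (i, j) * B $$ (j, i))"
    by (rule sum.swap)
  also have "\<dots> = mtrace (B * A)"
    using assms
    by (auto simp: mtrace_def scalar_prod_def atLeast0LessThan mult.commute intro!: sum.cong)
  finally show ?thesis .
qed

text \<open>By Schur triangularization the trace is the sum of the \<open>k\<close> roots of the
  characteristic polynomial, each of which is an eigenvalue.\<close>

lemma mtrace_bound:
  assumes A: "A \<in> carrier_mat k k"
    and ev: "\<And>e. eigenvalue A e \<Longrightarrow> cmod e \<le> r"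
  shows "cmod (mtrace A) \<le> real k * r"
proof -
  obtain es where es: "char_poly A = (\<Prod>e\<leftarrow>es. [:- e, 1:])" "length es = k"
    using char_poly_factorized[OF A] by blast
  obtain B P Q where BPQ: "schur_decomposition A es = (B, P, Q)"
    using prod_cases3 by blast
  have wit: "similar_mat_wit A B P Q" and diag: "diag_mat B = es"
    using schur_decomposition[OF A es(1) BPQ] by auto
  have cB: "B \<in> carrier_mat k k" and cP: "P \<in> carrier_mat k k" and cQ: "Q \<in> carrier_mat k k"
    and QP: "Q * P = 1\<^sub>m k" and eq: "A = P * B * Q"
    using similar_mat_witD2[OF A wit] by auto
  have "mtrace A = mtrace (P * (B * Q))"
    unfolding eq using cP cB cQ by simp
  also have "\<dots> = mtrace ((B * Q) * P)"
    by (rule mtrace_mult_comm[of _ k]) (use cP cB cQ in auto)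
  also have "(B * Q) * P = B"
    using cB cQ cP QP by simp
  finally have tr: "mtrace A = (\<Sum>i<k. es ! i)"
    using diag cB es(2) by (auto simp: mtrace_def diag_mat_def intro!: sum.cong)
  have "cmod (es ! i) \<le> r" if "i < k" for i
  proof (rule ev)
    have "poly (char_poly A) (es ! i) = 0"
      unfolding es(1) poly_prod_list using that es(2)
      by (auto simp: prod_list_zero_iff intro!: image_eqI[of _ _ "es ! i"])
    then show "eigenvalue A (es ! i)"
      using eigenvalue_root_char_poly[OF A] by blast
  qed
  then have "(\<Sum>i<k. cmod (es ! i)) \<le> (\<Sum>i<k. r)"
    by (intro sum_mono) auto
  then show ?thesis
    unfolding tr using norm_sum[of "\<lambda>i. es ! i" "{..<k}"] by simp
qed

lemma dim_mat_adjoint [simp]: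
  "dim_row (mat_adjoint A) = dim_col A" "dim_col (mat_adjoint A) = dim_row A"
  by (auto simp: mat_adjoint_def)

lemma index_mat_adjoint [simp]:
  "i < dim_col A \<Longrightarrow> j < dim_row A \<Longrightarrow> mat_adjoint A $$ (i, j) = conjugate (A $$ (j, i))"
  by (simp add: mat_adjoint_def mat_of_rows_index)

text \<open>This trace is the squared Hilbert-Schmidt norm, the sum of the squared moduli of all
  entries.\<close>

lemma mtrace_adjoint_mult_eq_0:
  assumes A: "A \<in> carrier_mat k k" and tr: "mtrace (mat_adjoint A * A) = 0"
  shows "A = 0\<^sub>m k k"
proof -
  have "mtrace (mat_adjoint A * A) = (\<Sum>i<k. \<Sum>j<k. cnj (A $$ (j, i)) * A $$ (j, i))"
    using A by (auto simp: mtrace_def scalar_prod_def atLeast0LessThan intro!: sum.cong)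
  also have "\<dots> = complex_of_real (\<Sum>i<k. \<Sum>j<k. (cmod (A $$ (j, i)))\<^sup>2)"
    by (simp only: of_real_sum complex_norm_square mult.commute)
  finally have "(\<Sum>i<k. \<Sum>j<k. (cmod (A $$ (j, i)))\<^sup>2) = 0"
    using tr by (metis of_real_eq_0_iff)
  then have "\<forall>i<k. \<forall>j<k. A $$ (j, i) = 0"
    by (simp add: sum_nonneg_eq_0_iff sum_nonneg)
  then show ?thesis using A by auto
qed

section \<open>The kernel of a finite dimensional representation\<close>

locale matrix_rep =
  fixes k :: nat and \<rho> :: "'c::cstar_algebra \<Rightarrow> complex mat"
  assumes rep: "matrix_star_rep k \<rho>"
begin

lemma rep_carrier [simp]: "\<rho> x \<in> carrier_mat k k"
  and rep_add: "\<rho> (x + y) = \<rho> x + \<rho> y"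
  and rep_scaleC: "\<rho> (c *\<^sub>C x) = c \<cdot>\<^sub>m \<rho> x"
  and rep_mult: "\<rho> (x * y) = \<rho> x * \<rho> y"
  and rep_adj: "\<rho> (adj x) = mat_adjoint (\<rho> x)"
  using rep by (auto simp: matrix_star_rep_def)

lemma rep_dim [simp]: "dim_row (\<rho> x) = k" "dim_col (\<rho> x) = k"
  using rep_carrier[of x] by (auto simp del: rep_carrier)

lemma rep_index_add: "p < k \<Longrightarrow> q < k \<Longrightarrow> \<rho> (x + y) $$ (p, q) = \<rho> x $$ (p, q) + \<rho> y $$ (p, q)"
  by (simp add: rep_add)

lemma rep_index_scaleC: "p < k \<Longrightarrow> q < k \<Longrightarrow> \<rho> (c *\<^sub>C x) $$ (p, q) = c * \<rho> x $$ (p, q)"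
  by (simp add: rep_scaleC)

lemma rep_zero: "\<rho> 0 = 0\<^sub>m k k"
proof -
  have "\<rho> 0 $$ (p, q) = 0" if "p < k" "q < k" for p q
    using rep_index_scaleC[OF that, of 0 0] by simp
  then show ?thesis by (auto intro!: eq_matI)
qed

lemma rep_index_sum:
  "p < k \<Longrightarrow> q < k \<Longrightarrow> \<rho> (\<Sum>i\<in>I. f i) $$ (p, q) = (\<Sum>i\<in>I. \<rho> (f i) $$ (p, q))"
  by (induction I rule: infinite_finite_induct) (auto simp: rep_zero rep_index_add)

lemma rep_index_diff:
  assumes "p < k" "q < k"
  shows "\<rho> (x - y) $$ (p, q) = \<rho> x $$ (p, q) - \<rho> y $$ (p, q)"
  using rep_index_add[OF assms, of "x - y" y] by simp

definition J :: "'c set" where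
  "J = {x. \<rho> x = 0\<^sub>m k k}"

lemma mem_J_iff: "x \<in> J \<longleftrightarrow> (\<forall>p<k. \<forall>q<k. \<rho> x $$ (p, q) = 0)"
  by (auto simp: J_def intro!: eq_matI)

lemma J_diff_iff: "x - y \<in> J \<longleftrightarrow> \<rho> x = \<rho> y"
  by (auto simp: mem_J_iff rep_index_diff intro!: eq_matI)

lemma J_zero [simp]: "0 \<in> J"
  by (simp add: J_def rep_zero)

lemma J_add: "x \<in> J \<Longrightarrow> y \<in> J \<Longrightarrow> x + y \<in> J"
  by (simp add: mem_J_iff rep_index_add)

lemma J_diff: "x \<in> J \<Longrightarrow> y \<in> J \<Longrightarrow> x - y \<in> J"
  by (simp add: mem_J_iff rep_index_diff)

lemma J_minus: "x \<in> J \<Longrightarrow> - x \<in> J"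
  using J_diff[of 0 x] by simp

lemma J_scaleC: "x \<in> J \<Longrightarrow> c *\<^sub>C x \<in> J"
  by (simp add: mem_J_iff rep_index_scaleC)

lemma scaleR_eq_scaleC: "r *\<^sub>R x = complex_of_real r *\<^sub>C (x::'c)"
  by (simp add: scaleC_of_real)

lemma J_scaleR: "x \<in> J \<Longrightarrow> r *\<^sub>R x \<in> J"
  by (simp add: scaleR_eq_scaleC J_scaleC)

lemma rep_scaleC_vec:
  "v \<in> carrier_vec k \<Longrightarrow> \<rho> (c *\<^sub>C x) *\<^sub>v v = c \<cdot>\<^sub>v (\<rho> x *\<^sub>v v)"
  by (auto simp: rep_scaleC intro!: eq_vecI)

lemma J_mult_left: "x \<in> J \<Longrightarrow> y * x \<in> J"
  by (simp add: J_def rep_mult)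

lemma J_mult_right: "x \<in> J \<Longrightarrow> x * y \<in> J"
  by (simp add: J_def rep_mult)

lemma J_adj: "x \<in> J \<Longrightarrow> adj x \<in> J"
  by (auto simp: J_def rep_adj intro!: eq_matI)

lemma J_cong: "x - y \<in> J \<Longrightarrow> x \<in> J \<longleftrightarrow> y \<in> J"
  unfolding J_diff_iff by (simp add: J_def)

text \<open>\<open>matrix_star_rep\<close> is purely algebraic, so the bound comes from
  quasi-invertibility: if \<open>cmod e\<close> exceeded \<open>norm x\<close>, then
  \<open>z\<close>, which is \<open>x\<close> divided by \<open>e\<close>, would admit
  \<open>y\<close> with \<open>y + z = y * z\<close>. Applied to an eigenvector \<open>v\<close>,
  which \<open>\<rho> z\<close> fixes, this identity forces \<open>v\<close> to vanish.\<close>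

lemma eigenvalue_bound:
  assumes "eigenvalue (\<rho> x) e"
  shows "cmod e \<le> norm x"
proof (rule ccontr)
  assume "\<not> cmod e \<le> norm x"
  then have less: "norm x < cmod e" by simp
  then have e: "e \<noteq> 0" by auto
  obtain v where v: "v \<in> carrier_vec k" "v \<noteq> 0\<^sub>v k" "\<rho> x *\<^sub>v v = e \<cdot>\<^sub>v v"
    using assms by (auto simp: eigenvalue_def eigenvector_def)
  define z where "z = inverse e *\<^sub>C x"
  have "norm z < 1"
    using less e by (simp add: z_def norm_scaleC norm_inverse mult.commute[of "inverse _"] divide_inverse[symmetric])
  then obtain y where "y = y * z - z"
    using quasi_inverse_exists by blast
  then have "y + z = y * z"
    by (metis diff_add_cancel)
  then have eq: "\<rho> y + \<rho> z = \<rho> y * \<rho> z"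
    by (metis rep_add rep_mult)
  have "\<rho> z *\<^sub>v v = inverse e \<cdot>\<^sub>v (\<rho> x *\<^sub>v v)"
    using v(1) by (auto simp: z_def rep_scaleC intro!: eq_vecI)
  then have zv: "\<rho> z *\<^sub>v v = v"
    using v e by (auto intro!: eq_vecI)
  have yv: "\<rho> y *\<^sub>v v \<in> carrier_vec k"
    by (auto intro!: mult_mat_vec_carrier[OF rep_carrier v(1)])
  have "\<rho> y *\<^sub>v v + v = (\<rho> y + \<rho> z) *\<^sub>v v"
    using add_mult_distrib_mat_vec[OF rep_carrier rep_carrier v(1), of y z] zv by simp
  also have "\<dots> = \<rho> y *\<^sub>v v"
    unfolding eq using assoc_mult_mat_vec[OF rep_carrier rep_carrier v(1), of y z] zv by simp
  finally have eqv: "\<rho> y *\<^sub>v v + v = \<rho> y *\<^sub>v v" .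
  have "v = 0\<^sub>v k"
  proof (rule eq_vecI)
    fix i assume "i < dim_vec (0\<^sub>v k :: complex vec)"
    then have "(\<rho> y *\<^sub>v v + v) $ i = (\<rho> y *\<^sub>v v) $ i + v $ i"
      using v(1) yv by (intro index_add_vec) auto
    then show "v $ i = 0\<^sub>v k $ i"
      using \<open>i < _\<close> unfolding eqv by simp
  qed (use v(1) in auto)
  with v(2) show False by simp
qed

section \<open>The trace form of the representation and closedness of its kernel\<close>

definition \<tau> :: "'c \<Rightarrow> complex" where
  "\<tau> x = mtrace (\<rho> x)"

lemma \<tau>_add: "\<tau> (x + y) = \<tau> x + \<tau> y"
  by (simp add: \<tau>_def rep_add mtrace_add[of _ k])

lemma \<tau>_J: "x \<in> J \<Longrightarrow> \<tau> x = 0"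
  by (simp add: \<tau>_def J_def mtrace_def)

lemma \<tau>_diff: "\<tau> (x - y) = \<tau> x - \<tau> y"
  using \<tau>_add[of "x - y" y] by simp

lemma \<tau>_cong: "x - y \<in> J \<Longrightarrow> \<tau> x = \<tau> y"
  by (simp add: \<tau>_def J_diff_iff)

text \<open>As \<open>\<tau>\<close> is additive, this gives its continuity, on which the two limit
  lemmas below rest.\<close>

lemma \<tau>_bound: "cmod (\<tau> x) \<le> real k * norm x"
  unfolding \<tau>_def by (rule mtrace_bound) (auto intro: eigenvalue_bound)

lemma \<tau>_adj_mult_eq_0: "\<tau> (adj x * x) = 0 \<Longrightarrow> x \<in> J"
  unfolding \<tau>_def J_def by (auto simp: rep_mult rep_adj intro: mtrace_adjoint_mult_eq_0)

lemma J_adj_multD: "adj x * x \<in> J \<Longrightarrow> x \<in> J"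
  by (rule \<tau>_adj_mult_eq_0) (rule \<tau>_J)

lemma J_adj_iff: "adj x \<in> J \<longleftrightarrow> x \<in> J"
  using J_adj[of x] J_adj[of "adj x"] by (auto simp: adj_adj)

lemma \<tau>_lim_eq_0:
  assumes "X \<longlonglongrightarrow> x" "\<And>n. \<tau> (X n) = 0"
  shows "\<tau> x = 0"
proof -
  have "cmod (\<tau> x) \<le> real k * norm (x - X n)" for n
    using \<tau>_bound[of "x - X n"] assms(2) by (simp add: \<tau>_diff)
  moreover have "(\<lambda>n. real k * norm (x - X n)) \<longlonglongrightarrow> real k * norm (x - x)"
    by (intro tendsto_intros assms)
  ultimately have "cmod (\<tau> x) \<le> real k * norm (x - x)"
    by (intro Lim_bounded2) auto
  then show ?thesis by simp
qed

text \<open>Closedness is read off from the trace: every \<open>adj x * X n\<close> lies in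
  \<open>J\<close> and has trace 0, hence so does the limit \<open>adj x * x\<close>, and the trace
  form is definite modulo \<open>J\<close>.\<close>

lemma J_lim:
  assumes "X \<longlonglongrightarrow> x" "\<And>n. X n \<in> J"
  shows "x \<in> J"
proof (rule \<tau>_adj_mult_eq_0)
  show "\<tau> (adj x * x) = 0"
  proof (rule \<tau>_lim_eq_0)
    show "(\<lambda>n. adj x * X n) \<longlonglongrightarrow> adj x * x"
      by (intro tendsto_intros assms)
  qed (simp add: \<tau>_J J_mult_left assms)
qed

section \<open>Linear relations in the image of the representation\<close>

lemma linear_dependence:
  fixes f :: "nat \<Rightarrow> 'c"
  shows "\<exists>c. (\<exists>m\<le>k * k. c m \<noteq> 0) \<and> (\<Sum>m\<le>k * k. c m *\<^sub>C f m) \<in> J"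
proof -
  define n where "n = k * k"
  \<comment> \<open>Column \<open>l\<close> lists the entries of \<open>\<rho> (f l)\<close> row by
    row. The appended zero row makes the matrix square and singular, so its kernel contains a
    nonzero vector of coefficients.\<close>
  define A where "A = mat (Suc n) (Suc n)
    (\<lambda>(i, l). if i < n then \<rho> (f l) $$ (i div k, i mod k) else 0)"
  have A: "A \<in> carrier_mat (Suc n) (Suc n)"
    by (simp add: A_def)
  have "transpose_mat A *\<^sub>v unit_vec (Suc n) n = 0\<^sub>v (Suc n)"
  proof (rule eq_vecI)
    fix i assume "i < dim_vec (0\<^sub>v (Suc n) :: complex vec)"
    then show "(transpose_mat A *\<^sub>v unit_vec (Suc n) n) $ i = 0\<^sub>v (Suc n) $ i"
      using A by (simp add: scalar_prod_right_unit) (simp add: A_def)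
  qed (use A in simp)
  moreover have "unit_vec (Suc n) n \<noteq> (0\<^sub>v (Suc n) :: complex vec)"
    by (metis index_unit_vec(2) index_zero_vec(1) lessI one_neq_zero)
  ultimately have "det (transpose_mat A) = 0"
    using det_0_iff_vec_prod_zero_field[of "transpose_mat A" "Suc n"] A
    by (meson transpose_carrier_mat unit_vec_carrier)
  then have "det A = 0"
    using det_transpose[OF A] by simp
  then obtain v where v: "v \<in> carrier_vec (Suc n)" "v \<noteq> 0\<^sub>v (Suc n)" "A *\<^sub>v v = 0\<^sub>v (Suc n)"
    using det_0_iff_vec_prod_zero_field[OF A] by auto
  have nz: "\<exists>m\<le>n. v $ m \<noteq> 0"
  proof (rule ccontr)
    assume "\<not> ?thesis"
    then have "v = 0\<^sub>v (Suc n)"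
      using v(1) by (intro eq_vecI) (auto simp: less_Suc_eq_le)
    with v(2) show False by simp
  qed
  have "(\<Sum>m\<le>n. v $ m *\<^sub>C f m) \<in> J"
    unfolding mem_J_iff
  proof (intro allI impI)
    fix p q assume pq: "p < k" "q < k"
    define i where "i = p * k + q"
    have "i < Suc p * k" using pq by (simp add: i_def)
    also have "\<dots> \<le> k * k" using pq by (intro mult_right_mono) auto
    finally have i: "i < n" by (simp add: n_def)
    have div: "i div k = p" "i mod k = q" using pq by (auto simp: i_def)
    have "0 = (A *\<^sub>v v) $ i" using v(3) i by simp
    also have "\<dots> = (\<Sum>l<Suc n. A $$ (i, l) * v $ l)"
      using A v(1) i by (simp add: scalar_prod_def atLeast0LessThan)
    also have "\<dots> = (\<Sum>l<Suc n. v $ l * \<rho> (f l) $$ (p, q))"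
      using i div by (intro sum.cong) (simp_all add: A_def)
    also have "\<dots> = \<rho> (\<Sum>m\<le>n. v $ m *\<^sub>C f m) $$ (p, q)"
      using pq by (simp add: rep_index_sum rep_index_scaleC lessThan_Suc_atMost)
    finally show "\<rho> (\<Sum>m\<le>n. v $ m *\<^sub>C f m) $$ (p, q) = 0" by simp
  qed
  with nz show ?thesis unfolding n_def by blast
qed

text \<open>A linear dependence is solved for its term of lowest index. For powers of a generator
  this expresses one power by strictly higher ones, from which the inverse is recovered
  later.\<close>

lemma linear_recurrence:
  fixes f :: "nat \<Rightarrow> 'c"
  shows "\<exists>m d c. f m - (\<Sum>i<d. c i *\<^sub>C f (Suc (m + i))) \<in> J"
proof -
  obtain c where ex: "\<exists>m\<le>k * k. c m \<noteq> 0" and sum: "(\<Sum>m\<le>k * k. c m *\<^sub>C f m) \<in> J"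
    using linear_dependence by blast
  define m where "m = (LEAST m. c m \<noteq> 0)"
  have cm: "c m \<noteq> 0" and least: "\<And>i. i < m \<Longrightarrow> c i = 0"
    using LeastI_ex[of "\<lambda>m. c m \<noteq> 0"] ex unfolding m_def by (auto dest: not_less_Least)
  have m: "m \<le> k * k"
    using ex Least_le[of "\<lambda>m. c m \<noteq> 0"] unfolding m_def by (meson order_trans)
  define d where "d = k * k - m"
  have kk: "Suc (k * k) = m + Suc d" using m by (simp add: d_def)
  have split: "sum g {..<m + e} = sum g {..<m} + (\<Sum>i<e. g (m + i))" for g :: "nat \<Rightarrow> 'c" and e
    by (induction e) (auto simp: add.assoc)
  have "(\<Sum>l\<le>k * k. c l *\<^sub>C f l) = (\<Sum>l<m + Suc d. c l *\<^sub>C f l)"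
    unfolding kk[symmetric] lessThan_Suc_atMost ..
  also have "\<dots> = (\<Sum>l<m. c l *\<^sub>C f l) + (\<Sum>i<Suc d. c (m + i) *\<^sub>C f (m + i))"
    by (rule split)
  also have "(\<Sum>l<m. c l *\<^sub>C f l) = 0"
    by (simp add: least)
  also have "(\<Sum>i<Suc d. c (m + i) *\<^sub>C f (m + i)) =
      c m *\<^sub>C f m + (\<Sum>i<d. c (Suc (m + i)) *\<^sub>C f (Suc (m + i)))"
    by (subst sum.lessThan_Suc_shift) simp
  finally have "c m *\<^sub>C f m + (\<Sum>i<d. c (Suc (m + i)) *\<^sub>C f (Suc (m + i))) \<in> J"
    using sum by simp
  then have "inverse (c m) *\<^sub>C (c m *\<^sub>C f m + (\<Sum>i<d. c (Suc (m + i)) *\<^sub>C f (Suc (m + i)))) \<in> J"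
    by (rule J_scaleC)
  then have "f m - (\<Sum>i<d. (- inverse (c m) * c (Suc (m + i))) *\<^sub>C f (Suc (m + i))) \<in> J"
    using cm by (simp add: scaleC_add_right scaleC_scaleC scaleC_sum_right sum_negf)
  then show ?thesis
    by (intro exI[of _ m] exI[of _ d] exI[of _ "\<lambda>i. - inverse (c m) * c (Suc (m + i))"])
qed

end

section \<open>Derivations preserve the kernel\<close>

lemma complex_subalgebra_diff:
  "complex_subalgebra B \<Longrightarrow> x \<in> B \<Longrightarrow> y \<in> B \<Longrightarrow> x - y \<in> B"
  by (metis complex_subalgebra_def diff_conv_add_uminus scaleC_minus_left scaleC_one)

lemma complex_subalgebra_sum:
  "complex_subalgebra B \<Longrightarrow> (\<And>i. i \<in> I \<Longrightarrow> f i \<in> B) \<Longrightarrow> (\<Sum>i\<in>I. f i) \<in> B"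
  by (induction I rule: infinite_finite_induct) (auto simp: complex_subalgebra_def)

text \<open>In the application \<open>B\<close> is the semicrossed product and \<open>B0\<close> the
  algebra spanned by products of its generators. The assumption \<open>star_closed\<close> makes the
  image of \<open>B0\<close> under \<open>\<rho>\<close> a \<open>*\<close>-algebra of matrices,
  although \<open>B0\<close> itself need not be self-adjoint.\<close>

locale rep_pair = matrix_rep k \<rho> for k and \<rho> :: "'c::cstar_algebra \<Rightarrow> complex mat" +
  fixes B B0 :: "'c set"
  assumes B: "complex_subalgebra B" and B0: "complex_subalgebra B0"
    and B0_B: "B0 \<subseteq> B" and dense: "B \<subseteq> closure B0"
    and star_closed: "\<And>b. b \<in> B0 \<Longrightarrow> \<exists>b'\<in>B0. b' - adj b \<in> J"
begin

lemma B_add: "x \<in> B \<Longrightarrow> y \<in> B \<Longrightarrow> x + y \<in> B"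
  and B_scaleC: "x \<in> B \<Longrightarrow> c *\<^sub>C x \<in> B"
  and B_mult: "x \<in> B \<Longrightarrow> y \<in> B \<Longrightarrow> x * y \<in> B"
  and B_zero: "0 \<in> B"
  using B by (auto simp: complex_subalgebra_def)

lemmas B_diff = complex_subalgebra_diff[OF B]

end

locale rep_derivation = rep_pair k \<rho> B B0
  for k and \<rho> :: "'c::cstar_algebra \<Rightarrow> complex mat" and B B0 +
  fixes D :: "'c \<Rightarrow> 'c"
  assumes D: "derivation_on B D"
begin

lemma D_B: "x \<in> B \<Longrightarrow> D x \<in> B"
  and D_add: "x \<in> B \<Longrightarrow> y \<in> B \<Longrightarrow> D (x + y) = D x + D y"
  and D_scaleC: "x \<in> B \<Longrightarrow> D (c *\<^sub>C x) = c *\<^sub>C D x"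
  and D_mult: "x \<in> B \<Longrightarrow> y \<in> B \<Longrightarrow> D (x * y) = D x * y + x * D y"
  and D_bound: "\<exists>K. \<forall>x\<in>B. norm (D x) \<le> K * norm x"
  using D by (auto simp: derivation_on_def bounded_linear_map_on_def)

lemma D_pow_B: "x \<in> B \<Longrightarrow> (D ^^ n) x \<in> B"
  by (induction n) (auto intro: D_B)

lemma D_pow_add: "x \<in> B \<Longrightarrow> y \<in> B \<Longrightarrow> (D ^^ n) (x + y) = (D ^^ n) x + (D ^^ n) y"
  by (induction n) (auto simp: D_add D_pow_B)

text \<open>\<open>F n\<close> consists of the elements on which the first \<open>n\<close> iterates \<open>D\<^sup>0, \<dots>, D\<^sup>n\<^sup>-\<^sup>1\<close> take values in
  \<open>J\<close>.\<close>

primrec F :: "nat \<Rightarrow> 'c set" where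
  "F 0 = B"
| "F (Suc n) = {w \<in> B \<inter> J. D w \<in> F n}"

lemma F_B: "w \<in> F n \<Longrightarrow> w \<in> B"
  by (cases n) auto

lemma F_mono: "w \<in> F (Suc n) \<Longrightarrow> w \<in> F n"
  by (induction n arbitrary: w) auto

lemma F_add: "w \<in> F n \<Longrightarrow> v \<in> F n \<Longrightarrow> w + v \<in> F n"
  by (induction n arbitrary: w v) (auto simp: D_add intro: B_add J_add)

lemma F_mult_left: "y \<in> B \<Longrightarrow> w \<in> F n \<Longrightarrow> y * w \<in> F n"
proof (induction n arbitrary: y w)
  case (Suc n)
  then have w: "w \<in> B" "w \<in> J" "D w \<in> F n" "w \<in> F n"
    using F_mono[of w n] by auto
  have "D (y * w) \<in> F n"
    unfolding D_mult[OF Suc.prems(1) w(1)] by (intro F_add Suc.IH D_B Suc.prems w)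
  then show ?case
    using w Suc.prems by (auto intro: B_mult J_mult_left)
qed (auto intro: B_mult)

text \<open>A factor from \<open>J\<close> raises the level by one: in
  \<open>D x * w + x * D w\<close> the first summand stays in the level of \<open>w\<close>, and in
  the second \<open>x\<close> makes up for the level that \<open>D w\<close> has lost.\<close>

lemma F_mult: "x \<in> B \<Longrightarrow> x \<in> J \<Longrightarrow> w \<in> F n \<Longrightarrow> x * w \<in> F (Suc n)"
proof (induction n arbitrary: w)
  case 0
  then show ?case by (auto intro: B_mult J_mult_right D_B)
next
  case (Suc n)
  then have w: "w \<in> B" "w \<in> J" "D w \<in> F n"
    by auto
  have "D (x * w) \<in> F (Suc n)"
    unfolding D_mult[OF Suc.prems(1) w(1)]
    by (intro F_add F_mult_left Suc.IH D_B Suc.prems w)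
  then show ?case
    using w Suc.prems by (auto intro: B_mult J_mult_right)
qed

lemma D_pow_F: "w \<in> F (Suc n) \<Longrightarrow> (D ^^ n) w \<in> J"
  by (induction n arbitrary: w) (auto simp: funpow_swap1)

text \<open>In the Leibniz expansion, each term that differentiates \<open>y\<close> leaves fewer
  than \<open>n\<close> derivatives on \<open>w\<close>, so it lies in \<open>J\<close>.\<close>

lemma D_pow_mult: "y \<in> B \<Longrightarrow> w \<in> F n \<Longrightarrow> (D ^^ n) (y * w) - y * (D ^^ n) w \<in> J"
proof (induction n arbitrary: y w)
  case (Suc n)
  then have w: "w \<in> B" "D w \<in> F n" by auto
  have eq: "(D ^^ Suc n) (y * w) = (D ^^ n) (D y * w) + (D ^^ n) (y * D w)"
    using Suc.prems w by (simp add: funpow_swap1 D_mult D_pow_add B_mult D_B del: funpow.simps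
        add: funpow_Suc_right)
  have "(D ^^ n) (D y * w) \<in> J"
    using Suc.prems by (intro D_pow_F F_mult_left D_B)
  moreover have "(D ^^ n) (y * D w) - y * (D ^^ n) (D w) \<in> J"
    using Suc.IH Suc.prems(1) w(2) by blast
  ultimately have "(D ^^ n) (D y * w) + ((D ^^ n) (y * D w) - y * (D ^^ n) (D w)) \<in> J"
    by (rule J_add)
  then show ?case
    unfolding eq by (simp add: funpow_swap1 add_diff_eq)
qed simp

text \<open>Of the Leibniz expansion only the term with one derivative on \<open>x\<close> and
  \<open>n\<close> on \<open>w\<close> survives, with binomial coefficient \<open>Suc n\<close>:
  without a derivative on \<open>x\<close> the factor \<open>x\<close> is in \<open>J\<close>, and
  with two or more the derivative of \<open>w\<close> is.\<close>

lemma D_pow_Suc_mult: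
  "x \<in> B \<Longrightarrow> x \<in> J \<Longrightarrow> w \<in> F n \<Longrightarrow>
    (D ^^ Suc n) (x * w) - real (Suc n) *\<^sub>R (D x * (D ^^ n) w) \<in> J"
proof (induction n arbitrary: w)
  case 0
  then show ?case by (auto simp: D_mult intro: J_mult_right)
next
  case (Suc n)
  then have w: "w \<in> B" "D w \<in> F n" by auto
  have eq: "(D ^^ Suc (Suc n)) (x * w) = (D ^^ Suc n) (D x * w) + (D ^^ Suc n) (x * D w)"
    using Suc.prems w by (simp add: D_mult D_pow_add B_mult D_B del: funpow.simps
        add: funpow_Suc_right[of "Suc n"])
  have 1: "(D ^^ Suc n) (D x * w) - D x * (D ^^ Suc n) w \<in> J"
    using Suc.prems by (intro D_pow_mult D_B)
  have 2: "(D ^^ Suc n) (x * D w) - real (Suc n) *\<^sub>R (D x * (D ^^ Suc n) w) \<in> J"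
    using Suc.IH[OF Suc.prems(1,2) w(2)] by (simp add: funpow_swap1)
  have "(D ^^ Suc (Suc n)) (x * w) - real (Suc (Suc n)) *\<^sub>R (D x * (D ^^ Suc n) w) =
      ((D ^^ Suc n) (D x * w) - D x * (D ^^ Suc n) w) +
      ((D ^^ Suc n) (x * D w) - real (Suc n) *\<^sub>R (D x * (D ^^ Suc n) w))"
    unfolding eq by (simp add: algebra_simps scaleR_2 del: funpow.simps)
  then show ?case using J_add[OF 1 2] by simp
qed

text \<open>The iterated multiplication stands for the power of \<open>x\<close> with exponent
  \<open>n + 1\<close>; there is no unit to start from. The factors \<open>Suc n\<close> of the
  preceding lemma accumulate to the factorial.\<close>

lemma D_pow_power:
  assumes "x \<in> B" "x \<in> J"
  shows "((*) x ^^ n) x \<in> F (Suc n)"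
    and "(D ^^ Suc n) (((*) x ^^ n) x) - fact (Suc n) *\<^sub>R ((*) (D x) ^^ n) (D x) \<in> J"
proof (induction n)
  case 0
  {
    case 1
    then show ?case using assms by (auto intro: D_B)
  next
    case 2
    then show ?case by simp
  }
next
  case (Suc n)
  {
    case 1
    then show ?case using F_mult[OF assms Suc.IH(1)] by simp
  next
    case 2
    define w where "w = ((*) x ^^ n) x"
    have 1: "(D ^^ Suc (Suc n)) (x * w) - real (Suc (Suc n)) *\<^sub>R (D x * (D ^^ Suc n) w) \<in> J"
      using Suc.IH(1) unfolding w_def by (intro D_pow_Suc_mult assms)
    have 2: "real (Suc (Suc n)) *\<^sub>R (D x * ((D ^^ Suc n) w -
        fact (Suc n) *\<^sub>R ((*) (D x) ^^ n) (D x))) \<in> J"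
      using Suc.IH(2) unfolding w_def by (intro J_scaleR J_mult_left)
    have alg: "(a - m *\<^sub>R (y * b)) + m *\<^sub>R (y * (b - f *\<^sub>R q)) = a - (m * f) *\<^sub>R (y * q)"
      for a b y q :: 'c and m f :: real
      by (simp add: right_diff_distrib scaleR_right_diff_distrib)
    have pow: "((*) y ^^ Suc n) z = y * ((*) y ^^ n) z" for y z :: 'c
      by simp
    show ?case
      using J_add[OF 1 2] unfolding alg pow w_def[symmetric] fact_Suc[of "Suc n"] of_nat_fact .
  }
qed

text \<open>Sinclair's argument: modulo \<open>J\<close>, \<open>D\<^sup>n(x\<^sup>n)\<close> is \<open>n! (D x)\<^sup>n\<close>, and the norm of the former grows
  only exponentially, so \<open>\<rho> (D x)\<close> has spectral radius 0.\<close>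

lemma \<tau>_D_eq_0:
  assumes x: "x \<in> B" "x \<in> J"
  shows "\<tau> (D x) = 0"
proof -
  obtain K0 where K0: "\<forall>x\<in>B. norm (D x) \<le> K0 * norm x"
    using D_bound by blast
  define K where "K = max K0 0"
  have K: "norm (D y) \<le> K * norm y" if "y \<in> B" for y
    using K0 that by (smt (verit) K_def mult_right_mono norm_ge_zero)
  have K_pos: "0 \<le> K" by (simp add: K_def)
  have Dn: "norm ((D ^^ n) y) \<le> K ^ n * norm y" if "y \<in> B" for n y
  proof (induction n)
    case (Suc n)
    have "norm ((D ^^ Suc n) y) \<le> K * norm ((D ^^ n) y)"
      using K D_pow_B that by simp
    also have "\<dots> \<le> K * (K ^ n * norm y)"
      by (intro mult_left_mono Suc.IH K_pos)
    finally show ?case by (simp add: mult.assoc)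
  qed simp
  have pow: "norm (((*) x ^^ n) x) \<le> norm x ^ Suc n" for n
  proof (induction n)
    case (Suc n)
    have "norm (((*) x ^^ Suc n) x) \<le> norm x * norm (((*) x ^^ n) x)"
      by (simp add: norm_mult_ineq)
    also have "\<dots> \<le> norm x * norm x ^ Suc n"
      by (intro mult_left_mono Suc.IH) simp
    finally show ?case by simp
  qed simp
  have "cmod (\<tau> (D x)) \<le> real k * 0"
    unfolding \<tau>_def
  proof (rule mtrace_bound)
    fix e assume "eigenvalue (\<rho> (D x)) e"
    then obtain v where v: "v \<in> carrier_vec k" "v \<noteq> 0\<^sub>v k" "\<rho> (D x) *\<^sub>v v = e \<cdot>\<^sub>v v"
      by (auto simp: eigenvalue_def eigenvector_def)
    have ev: "\<rho> (((*) (D x) ^^ n) (D x)) *\<^sub>v v = e ^ Suc n \<cdot>\<^sub>v v" for n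
    proof (induction n)
      case (Suc n)
      then show ?case
        using v assoc_mult_mat_vec[OF rep_carrier rep_carrier v(1)] mult_mat_vec[OF rep_carrier v(1)]
        by (simp add: rep_mult smult_smult_assoc mult.commute)
    qed (use v in simp)
    \<comment> \<open>Modulo \<open>J\<close>, an eigenvector of \<open>\<rho> (D x)\<close> is one
      of the image of \<open>(D ^^ Suc n) w\<close>, with eigenvalue
      \<open>fact (Suc n) * e ^ Suc n\<close>. \<open>eigenvalue_bound\<close> compares this with
      the norm, which is at most exponential in \<open>n\<close>.\<close>
    have le: "fact (Suc n) * cmod e ^ Suc n \<le> (K * norm x) ^ Suc n" for n
    proof -
      define w where "w = ((*) x ^^ n) x"
      have w: "w \<in> B" using D_pow_power(1)[OF x] F_B unfolding w_def by blast
      have "\<rho> ((D ^^ Suc n) w) = \<rho> (complex_of_real (fact (Suc n)) *\<^sub>C ((*) (D x) ^^ n) (D x))"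
        using D_pow_power(2)[OF x, of n] unfolding w_def J_diff_iff scaleR_eq_scaleC .
      then have "\<rho> ((D ^^ Suc n) w) *\<^sub>v v = of_real (fact (Suc n)) \<cdot>\<^sub>v (e ^ Suc n \<cdot>\<^sub>v v)"
        unfolding ev[of n, symmetric] rep_scaleC_vec[OF v(1), symmetric] by (rule arg_cong)
      then have "eigenvalue (\<rho> ((D ^^ Suc n) w)) (of_real (fact (Suc n)) * e ^ Suc n)"
        using v by (auto simp: eigenvalue_def eigenvector_def smult_smult_assoc
            simp del: power_Suc fact_Suc funpow.simps)
      from eigenvalue_bound[OF this]
      have "fact (Suc n) * cmod e ^ Suc n \<le> norm ((D ^^ Suc n) w)"
        by (simp add: norm_mult norm_power del: power_Suc fact_Suc funpow.simps)
      also have "\<dots> \<le> K ^ Suc n * norm w"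
        by (rule Dn[OF w])
      also have "\<dots> \<le> K ^ Suc n * norm x ^ Suc n"
        unfolding w_def by (intro mult_left_mono pow zero_le_power K_pos)
      finally show ?thesis by (simp only: power_mult_distrib)
    qed
    show "cmod e \<le> 0"
    proof (rule ccontr)
      assume "\<not> cmod e \<le> 0"
      then have e: "cmod e > 0" by simp
      \<comment> \<open>The inequality \<open>le\<close> says that the terms of the exponential
        series at \<open>q\<close> stay above 1, although they tend to 0.\<close>
      define q where "q = K * norm x / cmod e"
      have "(\<lambda>n. inverse (fact n) * q ^ n) \<longlonglongrightarrow> 0"
        by (rule summable_LIMSEQ_zero[OF summable_exp])
      then have "(\<lambda>n. inverse (fact (Suc n)) * q ^ Suc n) \<longlonglongrightarrow> 0"
        by (rule LIMSEQ_Suc)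
      moreover have "1 \<le> inverse (fact (Suc n)) * q ^ Suc n" for n
        using le[of n] e
        by (simp add: q_def power_divide field_simps del: power_Suc fact_Suc)
      ultimately have "(1::real) \<le> 0"
        by (intro Lim_bounded2) auto
      then show False by simp
    qed
  qed simp
  then show ?thesis by simp
qed

text \<open>Applying the trace lemma to \<open>x * z\<close> shows that \<open>D x\<close> is
  orthogonal to \<open>B\<close> under the trace form. Its own adjoint is a limit of adjoints from
  \<open>B0\<close>, which agree modulo \<open>J\<close> with elements of \<open>B0\<close>; so
  \<open>D x\<close> is orthogonal to its adjoint too, and definiteness applies.\<close>

lemma D_J:
  assumes x: "x \<in> B" "x \<in> J"
  shows "D x \<in> J"
proof -
  define y where "y = D x"
  have y: "y \<in> B" using x by (simp add: y_def D_B)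
  have ann: "\<tau> (y * z) = 0" if z: "z \<in> B" for z
  proof -
    have "\<tau> (D (x * z)) = 0"
      using x z by (intro \<tau>_D_eq_0 B_mult J_mult_right)
    moreover have "D (x * z) - y * z \<in> J"
      using x z by (simp add: y_def D_mult J_mult_right)
    ultimately show ?thesis using \<tau>_cong by metis
  qed
  obtain Z where Z: "\<And>n. Z n \<in> B0" "Z \<longlonglongrightarrow> y"
    using y dense closure_sequential[of y B0] by auto
  have "\<tau> (y * adj y) = 0"
  proof (rule \<tau>_lim_eq_0)
    have "(\<lambda>n. norm (adj (Z n) - adj y)) \<longlonglongrightarrow> 0"
      using Z(2) by (simp add: adj_diff[symmetric] LIM_zero tendsto_norm_zero)
    then have "(\<lambda>n. adj (Z n)) \<longlonglongrightarrow> adj y"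
      by (rule LIM_zero_cancel[OF tendsto_norm_zero_cancel])
    then show "(\<lambda>n. y * adj (Z n)) \<longlonglongrightarrow> y * adj y"
      by (intro tendsto_intros)
    fix n
    obtain b where b: "b \<in> B0" "b - adj (Z n) \<in> J"
      using star_closed Z(1) by blast
    have "y * b - y * adj (Z n) \<in> J"
      using J_mult_left[OF b(2), of y] by (simp add: right_diff_distrib)
    then show "\<tau> (y * adj (Z n)) = 0"
      using ann[of b] b(1) B0_B \<tau>_cong by (metis subsetD)
  qed
  then have "adj y \<in> J"
    using \<tau>_adj_mult_eq_0[of "adj y"] by (simp add: adj_adj)
  then show ?thesis by (simp add: J_adj_iff y_def)
qed

end

section \<open>Functional calculus for self-adjoint elements\<close>

text \<open>\<open>eval0 h p\<close> is \<open>h p(h)\<close>; the extra factor \<open>h\<close> is there because there is no unit.\<close>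

definition eval0 :: "'c::cstar_algebra \<Rightarrow> complex poly \<Rightarrow> 'c" where
  "eval0 h p = fold_coeffs (\<lambda>a y. a *\<^sub>C h + h * y) p 0"

lemma eval0_0 [simp]: "eval0 h 0 = 0"
  by (simp add: eval0_def)

lemma eval0_pCons: "eval0 h (pCons a p) = a *\<^sub>C h + h * eval0 h p"
  by (cases "p = 0 \<and> a = 0") (auto simp: eval0_def)

lemma eval0_add: "eval0 h (p + q) = eval0 h p + eval0 h q"
  by (induction p q rule: poly_induct2)
    (simp_all add: eval0_pCons scaleC_add_left distrib_left)

lemma eval0_smult: "eval0 h (Polynomial.smult c p) = c *\<^sub>C eval0 h p"
  by (induction p) (simp_all add: eval0_pCons scaleC_add_right scaleC_scaleC mult_scaleC_right)

lemma eval0_diff: "eval0 h (p - q) = eval0 h p - eval0 h q"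
  using eval0_add[of h "p - q" q] by simp

lemma eval0_sum: "eval0 h (\<Sum>i\<in>I. f i) = (\<Sum>i\<in>I. eval0 h (f i))"
  by (induction I rule: infinite_finite_induct) (auto simp: eval0_add)

text \<open>Of the two factors \<open>h\<close> in the product, one is absorbed into the polynomial
  as an extra variable, hence \<open>pCons 0\<close>.\<close>

lemma eval0_mult: "eval0 h p * eval0 h q = eval0 h (pCons 0 (p * q))"
  by (induction p)
    (simp_all add: eval0_pCons distrib_right distrib_left mult.assoc mult_scaleC_left
      mult_scaleC_right eval0_add eval0_smult)

lemma eval0_commute: "eval0 h p * eval0 h q = eval0 h q * eval0 h p"
  by (simp add: eval0_mult mult.commute)

lemma eval0_1: "eval0 h 1 = h"
  by (simp add: eval0_pCons one_pCons)

lemma adj_eval0: "adj (eval0 h p) = eval0 (adj h) (map_poly cnj p)"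
proof (induction p)
  case (pCons a p)
  have "adj (eval0 h (pCons a p)) = cnj a *\<^sub>C adj h + adj (eval0 h p) * adj h"
    by (simp add: eval0_pCons adj_add adj_mult adj_scaleC)
  also have "adj (eval0 h p) * adj h = adj h * adj (eval0 h p)"
    unfolding pCons.IH using eval0_commute[of "adj h" "map_poly cnj p" 1] by (simp add: eval0_1)
  finally show ?case
    using pCons by (simp add: eval0_pCons map_poly_pCons)
qed simp

lemma eval0_mem: "complex_subalgebra N \<Longrightarrow> h \<in> N \<Longrightarrow> eval0 h p \<in> N"
  by (induction p) (auto simp: eval0_pCons complex_subalgebra_def)

context matrix_rep
begin

lemma eval0_cong: "h - g \<in> J \<Longrightarrow> eval0 h p - eval0 g p \<in> J"
  by (induction p) (simp_all add: J_diff_iff eval0_pCons rep_add rep_scaleC rep_mult)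

lemma eval0_mult_J: "eval0 h p \<in> J \<Longrightarrow> eval0 h (p * q) \<in> J"
  by (induction q) (auto simp: eval0_add eval0_smult eval0_pCons intro: J_add J_scaleC J_mult_left)

context
  fixes h :: 'c
  assumes h: "adj h - h \<in> J"
begin

lemma rep_adj_eval0: "\<rho> (adj (eval0 h p)) = \<rho> (eval0 h (map_poly cnj p))"
  using eval0_cong[OF h] by (simp add: adj_eval0 J_diff_iff)

lemma eval0_normal: "\<rho> (adj (eval0 h p) * eval0 h p) = \<rho> (eval0 h p * adj (eval0 h p))"
  by (simp only: rep_mult rep_adj_eval0) (simp only: rep_mult[symmetric] eval0_commute)

text \<open>A normal matrix and its square have the same kernel. With \<open>u = y * z\<close>,
  normality turns \<open>y * u\<close> in \<open>J\<close> into \<open>adj y * u\<close> in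
  \<open>J\<close>, and multiplying by \<open>adj z\<close> gives \<open>adj u * u\<close>.\<close>

lemma eval0_square_cancel:
  assumes "eval0 h p * (eval0 h p * z) \<in> J"
  shows "eval0 h p * z \<in> J"
proof -
  define y where "y = eval0 h p"
  define u where "u = y * z"
  have normal: "\<rho> (adj y * y) = \<rho> (y * adj y)"
    unfolding y_def by (rule eval0_normal)
  have yu: "y * u \<in> J"
    using assms by (simp add: y_def u_def)
  have "\<rho> (adj (adj y * u) * (adj y * u)) = \<rho> (adj u) * \<rho> (y * adj y) * \<rho> u"
    by (simp only: rep_mult[symmetric] adj_mult adj_adj mult.assoc)
  also have "\<dots> = \<rho> (adj u * (adj y * (y * u)))"
    unfolding normal[symmetric] by (simp only: rep_mult[symmetric] mult.assoc)
  finally have "adj (adj y * u) * (adj y * u) \<in> J"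
    using yu J_mult_left unfolding J_def by simp
  then have "adj y * u \<in> J"
    by (rule J_adj_multD)
  then have "adj z * (adj y * u) \<in> J"
    by (rule J_mult_left)
  then have "adj u * u \<in> J"
    by (simp add: u_def adj_mult mult.assoc)
  then show ?thesis
    unfolding u_def y_def by (rule J_adj_multD)
qed

text \<open>A normal nilpotent matrix is zero. The free factor \<open>q\<close> replaces a unit:
  cancellation lowers the exponent to 1, and then \<open>q = map_poly cnj p\<close> yields the
  product of the element with its adjoint.\<close>

lemma eval0_nilpotent:
  assumes "\<And>q. eval0 h (pCons 0 p ^ n * q) \<in> J"
  shows "eval0 h p \<in> J"
proof -
  have "\<forall>q. eval0 h (pCons 0 p * q) \<in> J"
    using assms
  proof (induction n rule: less_induct)
    case (less n)
    consider "n = 0" | "n = 1" | m where "n = Suc (Suc m)"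
      by (metis One_nat_def not0_implies_Suc)
    then show ?case
    proof cases
      case 3
      have "eval0 h (pCons 0 p ^ Suc m * q) \<in> J" for q
      proof -
        have "eval0 h p * (eval0 h p * eval0 h (pCons 0 p ^ m * q)) \<in> J"
          using less.prems[of q] by (simp add: 3 eval0_mult mult.assoc)
        then have "eval0 h p * eval0 h (pCons 0 p ^ m * q) \<in> J"
          by (rule eval0_square_cancel)
        then show ?thesis
          by (simp add: eval0_mult mult.assoc)
      qed
      then show ?thesis using less.IH[of "Suc m"] 3 by simp
    qed (use less.prems in auto)
  qed
  then have "eval0 h p * eval0 h (map_poly cnj p) \<in> J"
    by (simp add: eval0_mult)
  then have "adj (eval0 h p) * eval0 h p \<in> J"
    unfolding J_def mem_Collect_eq eval0_normal by (simp add: rep_mult rep_adj_eval0)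
  then show ?thesis
    by (rule J_adj_multD)
qed

text \<open>A relation among the powers of \<open>h\<close> gives \<open>g\<close> nonzero with
  \<open>eval0 h g\<close> in \<open>J\<close>, and \<open>S\<close> consists of its nonzero roots.
  If \<open>p\<close> vanishes on \<open>S\<close>, then \<open>pCons 0 p\<close> vanishes at every
  root of \<open>g\<close>, the root 0 included; so \<open>g\<close> divides a power of it and
  \<open>eval0 h p\<close> is nilpotent modulo \<open>J\<close>.\<close>

lemma spectrum_exists:
  "\<exists>S. finite S \<and> 0 \<notin> S \<and> (\<forall>p. (\<forall>\<mu>\<in>S. poly p \<mu> = 0) \<longrightarrow> eval0 h p \<in> J)"
proof -
  obtain c where c: "\<exists>m\<le>k * k. c m \<noteq> 0"
    and sum: "(\<Sum>m\<le>k * k. c m *\<^sub>C eval0 h (monom 1 m)) \<in> J"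
    using linear_dependence[of "\<lambda>m. eval0 h (monom 1 m)"] by blast
  define g where "g = (\<Sum>m\<le>k * k. monom (c m) m)"
  have "coeff g m = c m" if "m \<le> k * k" for m
    using that by (simp add: g_def coeff_sum)
  then have g0: "g \<noteq> 0"
    using c by auto
  have "eval0 h g = (\<Sum>m\<le>k * k. c m *\<^sub>C eval0 h (monom 1 m))"
    by (simp add: g_def eval0_sum eval0_smult[symmetric] smult_monom)
  then have gJ: "eval0 h g \<in> J"
    using sum by simp
  show ?thesis
  proof (intro exI conjI allI impI)
    show "finite ({\<mu>. poly g \<mu> = 0} - {0})"
      using poly_roots_finite[OF g0] by simp
    fix p assume p: "\<forall>\<mu>\<in>{\<mu>. poly g \<mu> = 0} - {0}. poly p \<mu> = 0"
    have "g dvd pCons 0 p ^ degree g"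
      using nullstellensatz_univariate[of g "pCons 0 p"] p g0 by auto
    then obtain r where r: "pCons 0 p ^ degree g = g * r"
      by blast
    show "eval0 h p \<in> J"
      by (rule eval0_nilpotent[of p "degree g"]) (simp add: r mult.assoc eval0_mult_J gJ)
  qed simp
qed

text \<open>Modulo \<open>J\<close>, \<open>eval0 h p\<close> depends only on the function sending
  \<mu> in \<open>S\<close> to \<mu> times \<open>poly p \<mu>\<close>. Interpolating inverses
  therefore produces \<open>E \<mu>\<close> for the indicator of a point and \<open>e\<close> for
  the constant 1. Being polynomials in \<open>h\<close> without constant term, they lie in every
  subalgebra containing \<open>h\<close>.\<close>

lemma spectral_idempotents:
  obtains S e E where "finite S"
    "\<And>N. complex_subalgebra N \<Longrightarrow> h \<in> N \<Longrightarrow> e \<in> N \<and> (\<forall>\<mu>. E \<mu> \<in> N)"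
    "e * e - e \<in> J" "e * h - h \<in> J" "h * e - h \<in> J"
    "\<And>\<mu>. \<mu> \<in> S \<Longrightarrow> E \<mu> * E \<mu> - E \<mu> \<in> J"
    "(\<Sum>\<mu>\<in>S. \<mu> *\<^sub>C E \<mu>) - h \<in> J"
proof -
  obtain S where S: "finite S" "0 \<notin> S"
    and SJ: "\<forall>p. (\<forall>\<mu>\<in>S. poly p \<mu> = 0) \<longrightarrow> eval0 h p \<in> J"
    using spectrum_exists by (elim exE conjE)
  have eqJ: "eval0 h p - eval0 h q \<in> J" if "\<And>\<mu>. \<mu> \<in> S \<Longrightarrow> poly p \<mu> = poly q \<mu>" for p q
    unfolding eval0_diff[symmetric] using SJ that by simp
  \<comment> \<open>The Lagrange basis polynomials for the nodes \<open>S\<close>.\<close>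
  define L where "L \<mu> = (\<Prod>\<nu>\<in>S - {\<mu>}. Polynomial.smult (inverse (\<mu> - \<nu>)) [:- \<nu>, 1:])" for \<mu>
  have L: "poly (L \<mu>) \<nu> = (if \<nu> = \<mu> then 1 else 0)" if "\<mu> \<in> S" "\<nu> \<in> S" for \<mu> \<nu>
  proof (cases "\<nu> = \<mu>")
    case False
    then show ?thesis
      using that S(1) by (auto simp: L_def poly_prod intro!: prod_zero bexI[of _ \<nu>])
  next
    case True
    have "poly (Polynomial.smult (inverse (\<mu> - x)) [:- x, 1:]) \<mu> = 1" if "x \<in> S - {\<mu>}" for x
    proof -
      have "\<mu> - x \<noteq> 0" using that by auto
      from left_inverse[OF this] show ?thesis by (simp add: algebra_simps)
    qed
    then have "poly (L \<mu>) \<mu> = 1"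
      unfolding L_def poly_prod by (intro prod.neutral ballI)
    with True show ?thesis by simp
  qed
  define E where "E \<mu> = eval0 h (Polynomial.smult (inverse \<mu>) (L \<mu>))" for \<mu>
  define u where "u = (\<Sum>\<mu>\<in>S. Polynomial.smult (inverse \<mu>) (L \<mu>))"
  have u: "poly u \<nu> = inverse \<nu>" if "\<nu> \<in> S" for \<nu>
  proof -
    have "poly u \<nu> = (\<Sum>\<mu>\<in>S. if \<nu> = \<mu> then inverse \<mu> else 0)"
      unfolding u_def poly_sum by (intro sum.cong) (use that L in auto)
    then show ?thesis using that S(1) by simp
  qed
  have nz: "\<mu> \<noteq> 0" if "\<mu> \<in> S" for \<mu>
    using that S(2) by auto
  have "(\<Sum>\<mu>\<in>S. \<mu> *\<^sub>C E \<mu>) = eval0 h (\<Sum>\<mu>\<in>S. L \<mu>)"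
    unfolding eval0_sum by (intro sum.cong) (auto simp: E_def eval0_smult scaleC_scaleC nz)
  moreover have "eval0 h (\<Sum>\<mu>\<in>S. L \<mu>) - eval0 h 1 \<in> J"
  proof (rule eqJ)
    fix \<nu> assume \<nu>: "\<nu> \<in> S"
    have "poly (\<Sum>\<mu>\<in>S. L \<mu>) \<nu> = (\<Sum>\<mu>\<in>S. if \<nu> = \<mu> then 1 else 0)"
      unfolding poly_sum by (intro sum.cong) (use \<nu> L in auto)
    then show "poly (\<Sum>\<mu>\<in>S. L \<mu>) \<nu> = poly 1 \<nu>" using \<nu> S(1) by simp
  qed
  ultimately have sum: "(\<Sum>\<mu>\<in>S. \<mu> *\<^sub>C E \<mu>) - h \<in> J"
    by (simp add: eval0_1)
  show thesis
  proof (rule that[of S "eval0 h u" E])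
    show "eval0 h u * eval0 h u - eval0 h u \<in> J"
      unfolding eval0_mult by (rule eqJ) (simp add: u nz)
    have "eval0 h u * eval0 h 1 - eval0 h 1 \<in> J"
      unfolding eval0_mult by (rule eqJ) (simp add: u nz)
    then show "eval0 h u * h - h \<in> J" "h * eval0 h u - h \<in> J"
      using eval0_commute[of h u 1] by (simp_all add: eval0_1)
    show "E \<mu> * E \<mu> - E \<mu> \<in> J" if "\<mu> \<in> S" for \<mu>
      unfolding E_def eval0_mult by (rule eqJ) (use that in \<open>auto simp: L nz\<close>)
  qed (use S(1) sum eval0_mem E_def in auto)
qed

end

section \<open>Spanning by idempotents modulo the kernel\<close>

lemma adj_cong: "x - y \<in> J \<Longrightarrow> adj x - adj y \<in> J"
  using J_adj[of "x - y"] by (simp add: adj_diff)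

text \<open>These are the real and imaginary parts with \<open>a'\<close> in place of
  \<open>adj a\<close>, which may lie outside \<open>N\<close>.\<close>

lemma cartesian_decomposition:
  assumes N: "complex_subalgebra N" and a: "a \<in> N" and a': "a' \<in> N" "a' - adj a \<in> J"
  obtains g h where "g \<in> N" "h \<in> N" "adj g - g \<in> J" "adj h - h \<in> J" "a = g + \<i> *\<^sub>C h"
proof
  have "a + a' \<in> N" "a - a' \<in> N"
    using N a a'(1) complex_subalgebra_diff[OF N] by (auto simp: complex_subalgebra_def)
  moreover have "c *\<^sub>C x \<in> N" if "x \<in> N" for c x
    using N that by (simp add: complex_subalgebra_def)
  ultimately show "(1/2) *\<^sub>C (a + a') \<in> N" "(- \<i>/2) *\<^sub>C (a - a') \<in> N"
    by blast+
  have eq: "\<rho> a' = \<rho> (adj a)" "\<rho> (adj a') = \<rho> a"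
    using a'(2) adj_cong[OF a'(2)] by (simp_all add: J_diff_iff adj_adj)
  show "adj ((1/2) *\<^sub>C (a + a')) - (1/2) *\<^sub>C (a + a') \<in> J"
    unfolding J_diff_iff by (auto simp: adj_scaleC adj_add rep_add rep_scaleC eq intro!: eq_matI)
  have skew: "adj (c *\<^sub>C (a - a')) - c *\<^sub>C (a - a') \<in> J" if "cnj c = - c" for c
    unfolding J_diff_iff
    by (rule eq_matI) (auto simp: adj_scaleC adj_diff rep_index_scaleC rep_index_diff eq that algebra_simps
        simp del: scaleC_minus_left)
  show "adj ((- \<i>/2) *\<^sub>C (a - a')) - (- \<i>/2) *\<^sub>C (a - a') \<in> J"
    by (rule skew) simp
  have "2 *\<^sub>C a = a + a"
    using scaleC_add_left[of 1 1 a] by simp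
  then show "a = (1/2) *\<^sub>C (a + a') + \<i> *\<^sub>C ((- \<i>/2) *\<^sub>C (a - a'))"
    using scaleC_scaleC[of "1/2" 2 a]
    by (simp add: scaleC_scaleC scaleC_add_right[symmetric])
qed

text \<open>The Cartesian decomposition reduces to elements self-adjoint modulo \<open>J\<close>,
  and these are linear combinations of their spectral idempotents up to an error in \<open>J\<close>
  that \<open>cong\<close> absorbs.\<close>

lemma idempotent_induct:
  assumes N: "complex_subalgebra N" and star: "\<forall>b\<in>N. \<exists>b'\<in>N. b' - adj b \<in> J"
    and a: "a \<in> N"
    and add: "\<And>x y. x \<in> N \<Longrightarrow> y \<in> N \<Longrightarrow> Q x \<Longrightarrow> Q y \<Longrightarrow> Q (x + y)"
    and scale: "\<And>c x. x \<in> N \<Longrightarrow> Q x \<Longrightarrow> Q (c *\<^sub>C x)"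
    and cong: "\<And>x y. x \<in> N \<Longrightarrow> y \<in> N \<Longrightarrow> x - y \<in> J \<Longrightarrow> Q x \<Longrightarrow> Q y"
    and idem: "\<And>p. p \<in> N \<Longrightarrow> p * p - p \<in> J \<Longrightarrow> Q p"
  shows "Q a"
proof -
  have sa: "Q h" if h: "h \<in> N" "adj h - h \<in> J" for h
  proof -
    obtain S E where S: "finite S" "\<And>\<mu>. E \<mu> \<in> N"
      "\<And>\<mu>. \<mu> \<in> S \<Longrightarrow> E \<mu> * E \<mu> - E \<mu> \<in> J" "(\<Sum>\<mu>\<in>S. \<mu> *\<^sub>C E \<mu>) - h \<in> J"
      using spectral_idempotents[OF h(2)] N h(1) by metis
    have EN: "\<mu> *\<^sub>C E \<mu> \<in> N" for \<mu>
      using N S(2) by (simp add: complex_subalgebra_def)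
    have "Q (\<Sum>\<mu>\<in>T. \<mu> *\<^sub>C E \<mu>)" if "T \<subseteq> S" for T
      using finite_subset[OF that S(1)] that
    proof (induction T rule: finite_induct)
      case empty
      then show ?case using idem[of 0] N by (simp add: complex_subalgebra_def)
    next
      case (insert \<mu> T)
      have "Q (\<mu> *\<^sub>C E \<mu>)"
        using insert.prems S by (intro scale idem) auto
      moreover have "(\<Sum>\<mu>\<in>T. \<mu> *\<^sub>C E \<mu>) \<in> N"
        using EN by (rule complex_subalgebra_sum[OF N])
      ultimately show ?case
        using insert EN add by simp
    qed
    then show ?thesis
      using cong[OF complex_subalgebra_sum[OF N] h(1) S(4)] EN by blast
  qed
  obtain a' where "a' \<in> N" "a' - adj a \<in> J"
    using star a by blast
  then obtain g h where gh: "g \<in> N" "h \<in> N" "adj g - g \<in> J" "adj h - h \<in> J" "a = g + \<i> *\<^sub>C h"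
    using cartesian_decomposition[OF N a] by metis
  then have "Q (\<i> *\<^sub>C h)" "\<i> *\<^sub>C h \<in> N"
    using N scale[OF gh(2) sa[OF gh(2,4)]] by (simp_all add: complex_subalgebra_def)
  then show ?thesis
    using gh sa add by simp
qed

end

section \<open>Approximately local derivations modulo the kernel\<close>

locale rep_local_derivation = rep_pair k \<rho> B B0
  for k and \<rho> :: "'c::cstar_algebra \<Rightarrow> complex mat" and B B0 +
  fixes \<delta> :: "'c \<Rightarrow> 'c"
  assumes \<delta>: "approximately_local_derivation_on B \<delta>"
begin

lemma \<delta>_add: "x \<in> B \<Longrightarrow> y \<in> B \<Longrightarrow> \<delta> (x + y) = \<delta> x + \<delta> y"
  and \<delta>_scaleC: "x \<in> B \<Longrightarrow> \<delta> (c *\<^sub>C x) = c *\<^sub>C \<delta> x"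
  and \<delta>_bound: "\<exists>K. \<forall>x\<in>B. norm (\<delta> x) \<le> K * norm x"
  using \<delta> by (auto simp: approximately_local_derivation_on_def bounded_linear_map_on_def)

lemma \<delta>_diff: "x \<in> B \<Longrightarrow> y \<in> B \<Longrightarrow> \<delta> (x - y) = \<delta> x - \<delta> y"
  using \<delta>_add[of "x - y" y] by (simp add: B_diff)

text \<open>As \<open>J\<close> is closed, a membership valid for all derivations survives the
  limit. The approximating sequence depends on \<open>z\<close>, so \<open>\<Phi>\<close> sees the
  map at this single element.\<close>

lemma \<delta>_memJI:
  assumes z: "z \<in> B" and \<Phi>: "continuous_on UNIV \<Phi>"
    and D: "\<And>D. rep_derivation k \<rho> B B0 D \<Longrightarrow> \<Phi> (D z) \<in> J"
  shows "\<Phi> (\<delta> z) \<in> J"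
proof -
  obtain D where D': "\<And>n. derivation_on B (D n)" "(\<lambda>n. D n z) \<longlonglongrightarrow> \<delta> z"
    using \<delta> z unfolding approximately_local_derivation_on_def by blast
  show ?thesis
  proof (rule J_lim)
    show "(\<lambda>n. \<Phi> (D n z)) \<longlonglongrightarrow> \<Phi> (\<delta> z)"
      using continuous_on_tendsto_compose[OF \<Phi> D'(2)] by simp
    show "\<Phi> (D n z) \<in> J" for n
      by (intro D rep_derivation.intro rep_derivation_axioms.intro D'(1) rep_pair_axioms)
  qed
qed

lemma \<delta>_J: "z \<in> B \<Longrightarrow> z \<in> J \<Longrightarrow> \<delta> z \<in> J"
  using \<delta>_memJI[of z "\<lambda>w. w"] rep_derivation.D_J by fastforce

lemma J_addD: "x + y \<in> J \<Longrightarrow> x \<in> J \<Longrightarrow> y \<in> J"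
  using J_diff[of "x + y" x] by simp

text \<open>With \<open>\<alpha>, \<beta> \<in> {0, 1}\<close> this covers left multiplication by \<open>p\<close> and by \<open>1 - p\<close>, and right
  multiplication by \<open>q\<close> and by \<open>1 - q\<close>, although there is no unit.\<close>

lemma \<delta>_annihilate:
  assumes B: "z \<in> B" "p \<in> B" "q \<in> B"
    and l: "\<alpha> *\<^sub>R z + p * z \<in> J" and r: "\<beta> *\<^sub>R z + z * q \<in> J"
  shows "\<beta> *\<^sub>R (\<alpha> *\<^sub>R \<delta> z + p * \<delta> z) + (\<alpha> *\<^sub>R \<delta> z + p * \<delta> z) * q \<in> J"
proof (rule \<delta>_memJI[OF B(1)])
  show "continuous_on UNIV (\<lambda>w. \<beta> *\<^sub>R (\<alpha> *\<^sub>R w + p * w) + (\<alpha> *\<^sub>R w + p * w) * q)"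
    by (intro continuous_intros)
  fix D assume "rep_derivation k \<rho> B B0 D"
  then interpret rep_derivation k \<rho> B B0 D .
  define w where "w = \<alpha> *\<^sub>R D z + p * D z"
  have "D (\<alpha> *\<^sub>R z + p * z) = w + D p * z"
    using B by (simp add: w_def scaleR_eq_scaleC D_add D_scaleC D_mult B_scaleC B_mult)
  moreover have "D (\<alpha> *\<^sub>R z + p * z) \<in> J"
    using B l by (intro D_J B_add B_mult) (auto simp: scaleR_eq_scaleC B_scaleC)
  ultimately have 1: "w + D p * z \<in> J"
    by simp
  \<comment> \<open>Multiplying by \<beta> + \<open>q\<close> on the right turns the unwanted
    \<open>D p * z\<close> into \<open>D p\<close> times the element of assumption \<open>r\<close>,
    which lies in \<open>J\<close>.\<close>
  have "\<beta> *\<^sub>R (w + D p * z) + (w + D p * z) * q - D p * (\<beta> *\<^sub>R z + z * q) \<in> J"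
    by (intro J_diff J_add J_scaleR J_mult_right J_mult_left 1 r)
  then show "\<beta> *\<^sub>R w + w * q \<in> J"
    by (simp add: algebra_simps)
qed

section \<open>The ternary identity\<close>

definition tern :: "'c \<Rightarrow> 'c \<Rightarrow> 'c \<Rightarrow> 'c" where
  "tern a x b = \<delta> (a * x * b) - \<delta> (a * x) * b - a * \<delta> (x * b) + a * \<delta> x * b"

text \<open>Peirce decomposition: \<open>x\<close> splits into four corners according to
  \<open>p\<close>, \<open>1 - p\<close> on the left and \<open>q\<close>, \<open>1 - q\<close> on
  the right. For each corner, \<open>\<delta>_annihilate\<close> says that its image has no
  component in the opposite corner.\<close>

lemma tern_idempotents:
  assumes B: "p \<in> B" "q \<in> B" "x \<in> B" and p: "p * p - p \<in> J" and q: "q * q - q \<in> J"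
  shows "tern p x q \<in> J"
proof -
  have mp: "- p \<in> B" and mq: "- q \<in> B"
    using B B_diff[OF B_zero] by force+
  note mem = B_add B_diff B_mult B mp mq
  have p': "p * y - p * (p * y) \<in> J" for y
    using J_minus[OF J_mult_right[OF p, of y]] by (simp add: algebra_simps)
  have q': "y * q - y * q * q \<in> J" for y
    using J_minus[OF J_mult_left[OF q, of y]] by (simp add: algebra_simps)
  define w u v y where defs: "w = \<delta> (p * x * q)" "u = \<delta> (x * q)" "v = \<delta> (p * x)" "y = \<delta> x"
  have 1: "w - p * w - (w - p * w) * q \<in> J"
    using \<delta>_annihilate[of "p * x * q" "- p" "- q" 1 1] p'[of "x * q"] q'[of "p * x"]
    by (simp add: defs mem mult.assoc)
  have 2: "p * (u - w) - p * (u - w) * q \<in> J"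
    using \<delta>_annihilate[of "x * q - p * x * q" p "- q" 0 1] p'[of "x * q"] q'[of "x - p * x"]
    by (simp add: defs mem \<delta>_diff algebra_simps)
  have 3: "(v - w - p * (v - w)) * q \<in> J"
    using \<delta>_annihilate[of "p * x - p * x * q" "- p" q 1 0] p'[of "x - x * q"] q'[of "p * x"]
    by (simp add: defs mem \<delta>_diff algebra_simps)
  have e4: "\<delta> (x - p * x - (x * q - p * x * q)) = y - v - (u - w)"
    by (simp only: defs mem \<delta>_diff)
  have 4: "p * (y - v - (u - w)) * q \<in> J"
    using \<delta>_annihilate[of "x - p * x - (x * q - p * x * q)" p q 0 0]
      p'[of "x - x * q"] q'[of "x - p * x"]
    unfolding e4 by (simp add: mem algebra_simps)
  \<comment> \<open>The four corners of \<open>w\<close> add up to \<open>w\<close>, while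
    \<open>u\<close>, \<open>v\<close> and \<open>y\<close> contribute \<open>- p * u\<close>,
    \<open>- v * q\<close> and \<open>p * y * q\<close>; together this is
    \<open>tern p x q\<close>.\<close>
  have "(w - p * w - (w - p * w) * q) - (p * (u - w) - p * (u - w) * q)
      - (v - w - p * (v - w)) * q + p * (y - v - (u - w)) * q \<in> J"
    by (intro J_add J_diff 1 2 3 4)
  then show ?thesis
    unfolding tern_def defs[symmetric] by (simp add: algebra_simps)
qed

lemma tern_add_left:
  "a \<in> B \<Longrightarrow> a' \<in> B \<Longrightarrow> x \<in> B \<Longrightarrow> b \<in> B \<Longrightarrow> tern (a + a') x b = tern a x b + tern a' x b"
  by (simp add: tern_def \<delta>_add B_mult distrib_right)

lemma tern_add_right:
  "a \<in> B \<Longrightarrow> b' \<in> B \<Longrightarrow> x \<in> B \<Longrightarrow> b \<in> B \<Longrightarrow> tern a x (b + b') = tern a x b + tern a x b'"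
  by (simp add: tern_def \<delta>_add B_mult distrib_left)

lemma tern_scaleC_left:
  "a \<in> B \<Longrightarrow> x \<in> B \<Longrightarrow> b \<in> B \<Longrightarrow> tern (c *\<^sub>C a) x b = c *\<^sub>C tern a x b"
  by (simp add: tern_def \<delta>_scaleC B_mult mult_scaleC_left mult_scaleC_right scaleC_add_right
      scaleC_diff_right)

lemma tern_scaleC_right:
  "a \<in> B \<Longrightarrow> x \<in> B \<Longrightarrow> b \<in> B \<Longrightarrow> tern a x (c *\<^sub>C b) = c *\<^sub>C tern a x b"
  by (simp add: tern_def \<delta>_scaleC B_mult mult_scaleC_left mult_scaleC_right scaleC_add_right
      scaleC_diff_right)

lemma tern_J_left: "a \<in> B \<Longrightarrow> a \<in> J \<Longrightarrow> x \<in> B \<Longrightarrow> b \<in> B \<Longrightarrow> tern a x b \<in> J"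
  unfolding tern_def
  by (intro J_add J_diff J_mult_right \<delta>_J) (auto intro: B_mult J_mult_right)

lemma tern_J_right: "b \<in> B \<Longrightarrow> b \<in> J \<Longrightarrow> x \<in> B \<Longrightarrow> a \<in> B \<Longrightarrow> tern a x b \<in> J"
  unfolding tern_def
  by (intro J_add J_diff J_mult_left \<delta>_J) (auto intro: B_mult J_mult_left)

section \<open>Vanishing of the Leibniz defect modulo the kernel\<close>

definition defect :: "'c \<Rightarrow> 'c \<Rightarrow> 'c" where
  "defect a b = \<delta> (a * b) - \<delta> a * b - a * \<delta> b"

lemma defect_add_left:
  "a \<in> B \<Longrightarrow> a' \<in> B \<Longrightarrow> b \<in> B \<Longrightarrow> defect (a + a') b = defect a b + defect a' b"
  by (simp add: defect_def \<delta>_add B_mult distrib_right)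

lemma defect_add_right:
  "a \<in> B \<Longrightarrow> b \<in> B \<Longrightarrow> b' \<in> B \<Longrightarrow> defect a (b + b') = defect a b + defect a b'"
  by (simp add: defect_def \<delta>_add B_mult distrib_left)

lemma defect_scaleC_left: "a \<in> B \<Longrightarrow> b \<in> B \<Longrightarrow> defect (c *\<^sub>C a) b = c *\<^sub>C defect a b"
  by (simp add: defect_def \<delta>_scaleC B_mult mult_scaleC_left scaleC_diff_right)

lemma defect_scaleC_right: "a \<in> B \<Longrightarrow> b \<in> B \<Longrightarrow> defect a (c *\<^sub>C b) = c *\<^sub>C defect a b"
  by (simp add: defect_def \<delta>_scaleC B_mult mult_scaleC_right scaleC_diff_right)

lemma defect_J_left: "a \<in> B \<Longrightarrow> a \<in> J \<Longrightarrow> b \<in> B \<Longrightarrow> defect a b \<in> J"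
  unfolding defect_def by (intro J_diff J_mult_right \<delta>_J B_mult)

lemma defect_J_right: "a \<in> B \<Longrightarrow> b \<in> J \<Longrightarrow> b \<in> B \<Longrightarrow> defect a b \<in> J"
  unfolding defect_def by (intro J_diff J_mult_left \<delta>_J B_mult)

lemma defect_cong_left:
  assumes "a \<in> B" "a' \<in> B" "b \<in> B" "a - a' \<in> J" "defect a b \<in> J"
  shows "defect a' b \<in> J"
  using J_addD[of "defect (a - a') b" "defect a' b"] defect_add_left[of "a - a'" a' b]
    defect_J_left[of "a - a'" b] assms B_diff by simp

lemma defect_cong_right:
  assumes "a \<in> B" "b \<in> B" "b' \<in> B" "b - b' \<in> J" "defect a b \<in> J"
  shows "defect a b' \<in> J"
  using J_addD[of "defect a (b - b')" "defect a b'"] defect_add_right[of a "b - b'" b']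
    defect_J_right[of a "b - b'"] assms B_diff by simp

text \<open>Together with its right-hand counterpart this is the use of \<open>tern\<close>: once it
  lies in \<open>J\<close>, outer factors can be pulled out of the defect.\<close>

lemma defect_mult_left: "defect (a * x) b = a * defect x b + tern a x b"
  by (simp add: defect_def tern_def algebra_simps)

lemma defect_mult_right: "defect a (x * b) = defect a x * b + tern a x b"
  by (simp add: defect_def tern_def algebra_simps)

text \<open>Up to \<delta> of \<open>e * e - e\<close>, which is in \<open>J\<close>, the expression
  involves \<delta> only at \<open>e\<close>, so it can be tested on derivations. There it equals
  minus the image of \<open>e * e - e\<close>.\<close>

lemma defect_idempotent:
  assumes "e \<in> B" "e * e - e \<in> J"
  shows "defect e e \<in> J"
proof -
  have "\<delta> e - \<delta> e * e - e * \<delta> e \<in> J"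
  proof (rule \<delta>_memJI[of e "\<lambda>w. w - w * e - e * w"])
    fix D assume "rep_derivation k \<rho> B B0 D"
    then interpret rep_derivation k \<rho> B B0 D .
    have "D (e * e - e + e) = D (e * e - e) + D e"
      using assms by (intro D_add B_diff B_mult)
    then have "D e - D e * e - e * D e = - D (e * e - e)"
      using assms by (simp add: D_mult algebra_simps)
    then show "D e - D e * e - e * D e \<in> J"
      using assms by (auto intro!: J_minus D_J B_diff B_mult)
  qed (intro assms continuous_intros)+
  moreover have "\<delta> (e * e - e) \<in> J"
    using assms by (intro \<delta>_J B_diff B_mult)
  ultimately have "(\<delta> e - \<delta> e * e - e * \<delta> e) + \<delta> (e * e - e) \<in> J"
    by (rule J_add)
  moreover have "defect e e = (\<delta> e - \<delta> e * e - e * \<delta> e) + \<delta> (e * e - e)"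
    using assms by (simp add: defect_def \<delta>_diff B_mult)
  ultimately show ?thesis by simp
qed

lemma memB: "b \<in> B0 \<Longrightarrow> b \<in> B"
  using B0_B by auto

lemma star_closed': "\<forall>b\<in>B0. \<exists>b'\<in>B0. b' - adj b \<in> J"
  using star_closed by blast

lemmas B0_induct = idempotent_induct[OF B0 star_closed', consumes 1, case_names add scale cong idem]

lemma B0_mult: "a \<in> B0 \<Longrightarrow> b \<in> B0 \<Longrightarrow> a * b \<in> B0"
  and B0_add: "a \<in> B0 \<Longrightarrow> b \<in> B0 \<Longrightarrow> a + b \<in> B0"
  using B0 by (auto simp: complex_subalgebra_def)

lemma tern_J:
  assumes "a \<in> B0" "x \<in> B0" "b \<in> B0"
  shows "tern a x b \<in> J"
  using assms(1)
proof (induction a rule: B0_induct)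
  case (add a a')
  then show ?case using assms by (simp add: tern_add_left memB J_add)
next
  case (scale c a)
  then show ?case using assms by (simp add: tern_scaleC_left memB J_scaleC)
next
  case (cong a a')
  have "tern a x b = tern (a - a') x b + tern a' x b"
    using tern_add_left[of "a - a'" a' x b] cong assms by (simp add: memB B_diff)
  moreover have "tern (a - a') x b \<in> J"
    using cong assms by (intro tern_J_left B_diff memB)
  ultimately show ?case
    using cong J_addD by metis
next
  case (idem p)
  show ?case
    using assms(3)
  proof (induction b rule: B0_induct)
    case (add b b')
    then show ?case using assms idem by (simp add: tern_add_right memB J_add)
  next
    case (scale c b)
    then show ?case using assms idem by (simp add: tern_scaleC_right memB J_scaleC)
  next
    case (cong b b')
    have "tern p x b = tern p x (b - b') + tern p x b'"
      using tern_add_right[of p b' x "b - b'"] cong assms idem by (simp add: memB B_diff)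
    moreover have "tern p x (b - b') \<in> J"
      using cong assms idem by (intro tern_J_right B_diff memB)
    ultimately show ?case
      using cong J_addD by metis
  next
    case (idem q)
    with \<open>p \<in> B0\<close> \<open>p * p - p \<in> J\<close> assms show ?case
      by (intro tern_idempotents memB)
  qed
qed

lemma defect_mult_left_J:
  "a \<in> B0 \<Longrightarrow> x \<in> B0 \<Longrightarrow> b \<in> B0 \<Longrightarrow> defect x b \<in> J \<Longrightarrow> defect (a * x) b \<in> J"
  by (simp add: defect_mult_left J_add J_mult_left tern_J)

lemma defect_mult_right_J_iff:
  "a \<in> B0 \<Longrightarrow> x \<in> B0 \<Longrightarrow> b \<in> B0 \<Longrightarrow> defect a (x * b) \<in> J \<longleftrightarrow> defect a x * b \<in> J"
  using J_cong[of "defect a (x * b)" "defect a x * b"] by (simp add: defect_mult_right tern_J)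

text \<open>With \<open>e\<close> a unit for \<open>h\<close> modulo \<open>J\<close>, the defect at
  \<open>e\<close>, \<open>h\<close> is that at \<open>e\<close>, \<open>e\<close> times
  \<open>h\<close>, hence in \<open>J\<close>; writing the left \<open>h\<close> as
  \<open>h * e\<close> then pulls out \<open>h\<close>.\<close>

lemma defect_self_adjoint:
  assumes h: "h \<in> B0" "adj h - h \<in> J"
  shows "defect h h \<in> J"
proof -
  obtain e where e: "e \<in> B0" "e * e - e \<in> J" "e * h - h \<in> J" "h * e - h \<in> J"
    using spectral_idempotents[OF h(2)] B0 h(1) by metis
  have "defect e (e * h) \<in> J"
    using defect_idempotent[OF memB[OF e(1)] e(2)] e h
    by (simp add: defect_mult_right_J_iff J_mult_right)
  then have "defect e h \<in> J"
    by (rule defect_cong_right[rotated -1]) (use e h in \<open>auto intro: memB B_mult\<close>)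
  then have "defect (h * e) h \<in> J"
    using e h by (intro defect_mult_left_J)
  then show ?thesis
    by (rule defect_cong_left[rotated -1]) (use e h in \<open>auto intro: memB B_mult\<close>)
qed

text \<open>Polarization of the preceding lemma gives the case of self-adjoint arguments; the
  Cartesian decomposition extends it by bilinearity.\<close>

lemma defect_antisymmetric:
  assumes a: "a \<in> B0" and b: "b \<in> B0"
  shows "defect a b + defect b a \<in> J"
proof -
  have sa: "defect g h + defect h g \<in> J"
    if g: "g \<in> B0" "adj g - g \<in> J" and h: "h \<in> B0" "adj h - h \<in> J" for g h
  proof -
    have "adj (g + h) - (g + h) \<in> J"
      using J_add[OF g(2) h(2)] by (simp add: adj_add algebra_simps)
    with B0_add[OF g(1) h(1)] have "defect (g + h) (g + h) \<in> J"
      by (rule defect_self_adjoint)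
    then have "defect (g + h) (g + h) - defect g g - defect h h \<in> J"
      by (rule J_diff[OF J_diff[OF _ defect_self_adjoint[OF g]] defect_self_adjoint[OF h]])
    then show ?thesis
      using g h by (simp add: defect_add_left defect_add_right memB B_add algebra_simps)
  qed
  have lin: "defect (g + c *\<^sub>C h) f + defect f (g + c *\<^sub>C h) \<in> J"
    if "g \<in> B0" "h \<in> B0" "f \<in> B0" "defect g f + defect f g \<in> J" "defect h f + defect f h \<in> J"
    for c f g h
    using J_add[OF that(4) J_scaleC[OF that(5), of c]] that
    by (simp add: defect_add_left defect_add_right defect_scaleC_left defect_scaleC_right memB
        B_scaleC scaleC_add_right algebra_simps)
  obtain g h where a': "g \<in> B0" "h \<in> B0" "adj g - g \<in> J" "adj h - h \<in> J" "a = g + \<i> *\<^sub>C h"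
    using cartesian_decomposition[OF B0 a] star_closed[OF a] by metis
  obtain g' h' where b': "g' \<in> B0" "h' \<in> B0" "adj g' - g' \<in> J" "adj h' - h' \<in> J" "b = g' + \<i> *\<^sub>C h'"
    using cartesian_decomposition[OF B0 b] star_closed[OF b] by metis
  have half: "defect a f + defect f a \<in> J" if "f \<in> B0" "adj f - f \<in> J" for f
    unfolding a'(5) by (intro lin sa a' that)
  have "defect b a + defect a b \<in> J"
    unfolding b'(5)
    by (rule lin) (use half[OF b'(1,3)] half[OF b'(2,4)] a b' in \<open>simp_all add: add.commute\<close>)
  then show ?thesis
    by (simp add: add.commute)
qed

text \<open>Modulo \<open>J\<close>, \<open>defect (p * q) q\<close> is \<open>p\<close> times
  \<open>defect q q\<close>, hence 0. Swapping its arguments gives \<open>defect q p * q\<close>,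
  and swapping once more gives \<open>defect p q * q\<close>, which is
  \<open>defect p (q * q)\<close>.\<close>

lemma defect_idempotents:
  assumes p: "p \<in> B0" and q: "q \<in> B0" "q * q - q \<in> J"
  shows "defect p q \<in> J"
proof -
  have "defect (p * q) q \<in> J"
    using p q by (intro defect_mult_left_J defect_idempotent memB)
  moreover have "defect (p * q) q + defect q (p * q) \<in> J"
    using p q by (intro defect_antisymmetric B0_mult)
  ultimately have "defect q (p * q) \<in> J"
    using J_addD by blast
  then have "defect q p * q \<in> J"
    using p q by (simp add: defect_mult_right_J_iff)
  moreover have "defect q p * q + defect p q * q \<in> J"
    using J_mult_right[OF defect_antisymmetric[OF q(1) p], of q] by (simp add: distrib_right)
  ultimately have "defect p (q * q) \<in> J"
    using J_addD p q by (simp add: defect_mult_right_J_iff)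
  then show ?thesis
    by (rule defect_cong_right[rotated -1]) (use p q in \<open>auto intro: memB B_mult\<close>)
qed

lemma defect_J0:
  assumes a: "a \<in> B0" and b: "b \<in> B0"
  shows "defect a b \<in> J"
  using b
proof (induction b rule: B0_induct)
  case (add b b')
  then show ?case using a by (simp add: defect_add_right memB J_add)
next
  case (scale c b)
  then show ?case using a by (simp add: defect_scaleC_right memB J_scaleC)
next
  case (cong b b')
  then show ?case using a by (auto intro: defect_cong_right memB)
next
  case (idem q)
  then show ?case using a by (intro defect_idempotents)
qed

text \<open>Boundedness of \<delta> makes the defect continuous, so the result passes from the dense
  \<open>B0\<close> to \<open>B\<close>.\<close>

lemma defect_J:
  assumes a: "a \<in> B" and b: "b \<in> B"
  shows "defect a b \<in> J"
proof -
  obtain K where K: "\<forall>x\<in>B. norm (\<delta> x) \<le> K * norm x"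
    using \<delta>_bound by blast
  have lim: "(\<lambda>n. \<delta> (X n)) \<longlonglongrightarrow> \<delta> x"
    if "X \<longlonglongrightarrow> x" "\<And>n. X n \<in> B" "x \<in> B" for X x
  proof -
    have "(\<lambda>n. K * norm (X n - x)) \<longlonglongrightarrow> K * 0"
      using that(1) by (intro tendsto_intros) (simp add: LIM_zero tendsto_norm_zero)
    then have "(\<lambda>n. \<delta> (X n) - \<delta> x) \<longlonglongrightarrow> 0"
      by (intro Lim_null_comparison[of "\<lambda>n. \<delta> (X n) - \<delta> x" "\<lambda>n. K * norm (X n - x)"])
        (use K that B_diff \<delta>_diff in \<open>auto simp flip: \<delta>_diff\<close>)
    then show ?thesis by (rule LIM_zero_cancel)
  qed
  obtain X Y where X: "\<And>n. X n \<in> B0" "X \<longlonglongrightarrow> a" and Y: "\<And>n. Y n \<in> B0" "Y \<longlonglongrightarrow> b"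
    using a b dense closure_sequential[of a B0] closure_sequential[of b B0] by (metis subsetD)
  show ?thesis
  proof (rule J_lim)
    show "(\<lambda>n. defect (X n) (Y n)) \<longlonglongrightarrow> defect a b"
      unfolding defect_def
      by (intro tendsto_intros lim X Y B_mult memB a b)
    show "defect (X n) (Y n) \<in> J" for n
      by (intro defect_J0 X Y)
  qed
qed

end

section \<open>The algebra generated by a set\<close>

definition subalgebra_generated :: "'c::cstar_algebra set \<Rightarrow> 'c set" where
  "subalgebra_generated S = \<Inter>{B. complex_subalgebra B \<and> S \<subseteq> B}"

lemma subalgebra_generated: "complex_subalgebra (subalgebra_generated S)"
  unfolding subalgebra_generated_def complex_subalgebra_def by blast

lemma subalgebra_generated_superset: "S \<subseteq> subalgebra_generated S"
  unfolding subalgebra_generated_def by blast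

lemma subalgebra_generated_least:
  "complex_subalgebra B \<Longrightarrow> S \<subseteq> B \<Longrightarrow> subalgebra_generated S \<subseteq> B"
  unfolding subalgebra_generated_def by blast

lemma complex_subalgebra_closed_subalgebra_generated:
  "complex_subalgebra (closed_subalgebra_generated S)"
  unfolding closed_subalgebra_generated_def complex_subalgebra_def by blast

lemma complex_subalgebra_closure:
  assumes B: "complex_subalgebra B"
  shows "complex_subalgebra (closure B)"
  unfolding complex_subalgebra_def
proof (intro conjI ballI allI)
  show "0 \<in> closure B"
    using B closure_subset by (auto simp: complex_subalgebra_def)
next
  fix x y assume "x \<in> closure B" "y \<in> closure B"
  then obtain X Y where X: "\<And>n. X n \<in> B" "X \<longlonglongrightarrow> x" and Y: "\<And>n. Y n \<in> B" "Y \<longlonglongrightarrow> y"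
    unfolding closure_sequential by auto
  show "x + y \<in> closure B"
    unfolding closure_sequential
    by (rule exI[of _ "\<lambda>n. X n + Y n"])
      (use B X Y in \<open>auto simp: complex_subalgebra_def intro!: tendsto_intros\<close>)
  show "x * y \<in> closure B"
    unfolding closure_sequential
    by (rule exI[of _ "\<lambda>n. X n * Y n"])
      (use B X Y in \<open>auto simp: complex_subalgebra_def intro!: tendsto_intros\<close>)
next
  fix c x assume "x \<in> closure B"
  then obtain X where X: "\<And>n. X n \<in> B" "X \<longlonglongrightarrow> x"
    unfolding closure_sequential by auto
  show "c *\<^sub>C x \<in> closure B"
    unfolding closure_sequential
    by (rule exI[of _ "\<lambda>n. c *\<^sub>C X n"])
      (use B X bounded_linear.tendsto[OF bounded_linear_scaleC] in
        \<open>auto simp: complex_subalgebra_def\<close>)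
qed

lemma closed_subalgebra_generated_dense:
  "closed_subalgebra_generated S \<subseteq> closure (subalgebra_generated S)"
proof -
  have "S \<subseteq> closure (subalgebra_generated S)"
    using subalgebra_generated_superset closure_subset by blast
  then show ?thesis
    unfolding closed_subalgebra_generated_def
    using complex_subalgebra_closure[OF subalgebra_generated, of S] by auto
qed

lemma subalgebra_generated_subset_closed:
  "subalgebra_generated S \<subseteq> closed_subalgebra_generated S"
  unfolding closed_subalgebra_generated_def subalgebra_generated_def by blast

section \<open>Monomials in the crossed product\<close>

lemma free_inv_right: "s * free_inv s = (1 :: 'n free_group)"
proof -
  have "free_inv (free_inv s) * free_inv s * s = s"
    by (simp add: free_inv_left)
  then have "free_inv (free_inv s) = s"
    by (metis free_inv_left mult.assoc mult.right_neutral)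
  then show ?thesis using free_inv_left[of "free_inv s"] by simp
qed

lemma mult_free_inv_cancel_right: "t * s * free_inv (r * s) = t * free_inv (r :: 'n free_group)"
proof -
  have "s * free_inv (r * s) = free_inv r * (r * s * free_inv (r * s))"
    by (simp only: mult.assoc[symmetric] free_inv_left mult_1_left)
  then show ?thesis by (simp add: free_inv_right mult.assoc)
qed

lemma star_automorphism_id: "star_automorphism (\<lambda>x. x)"
  by (simp add: star_automorphism_def bij_id[unfolded id_def])

lemma star_automorphism_comp:
  "star_automorphism f \<Longrightarrow> star_automorphism g \<Longrightarrow> star_automorphism (\<lambda>x. f (g x))"
  unfolding star_automorphism_def using bij_comp[of g f] by (auto simp: comp_def)

lemma star_automorphism_inv:
  assumes f: "star_automorphism f"
  shows "star_automorphism (inv_into UNIV f)"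
proof -
  have bij: "bij f" using f by (simp add: star_automorphism_def)
  have inv: "inv_into UNIV f (f x) = x" "f (inv_into UNIV f x) = x" for x
    using bij by (simp_all add: bij_is_inj bij_is_surj surj_f_inv_f)
  have eqI: "inv_into UNIV f x = y" if "x = f y" for x y
    using that inv by simp
  show ?thesis
    unfolding star_automorphism_def
    by (intro conjI allI eqI bij_imp_bij_inv[OF bij])
      (use f in \<open>simp_all add: star_automorphism_def inv\<close>)
qed

locale crossed_product =
  fixes \<sigma> :: "'n \<Rightarrow> 'a::cstar_algebra \<Rightarrow> 'a"
    and j :: "('n, 'a) conv \<Rightarrow> 'c::cstar_algebra"
  assumes \<sigma>: "\<And>i. star_automorphism (\<sigma> i)"
    and j: "full_crossed_product \<sigma> j"
begin

section \<open>The free group action and the monomials it governs\<close>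

lemma letter_action: "star_automorphism (letter_action \<sigma> x)"
  by (simp add: letter_action_def \<sigma> star_automorphism_inv)

lemma letter_action_flip: "letter_action \<sigma> x (letter_action \<sigma> (flip x) a) = a"
proof -
  have "bij (\<sigma> i)" for i using \<sigma>[of i] by (simp add: star_automorphism_def)
  then show ?thesis
    by (cases x) (simp add: letter_action_def bij_is_inj bij_is_surj surj_f_inv_f)
qed

lemma star_automorphism_action: "star_automorphism (action \<sigma> s)"
proof -
  have "star_automorphism (foldr (letter_action \<sigma>) w)" for w
  proof (induction w)
    case (Cons x w)
    from star_automorphism_comp[OF letter_action[of x] this] show ?case
      by (simp add: comp_def)
  qed (simp add: star_automorphism_id id_def)
  then show ?thesis by (simp add: action_def)
qed

lemma action_add: "action \<sigma> s (a + b) = action \<sigma> s a + action \<sigma> s b"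
  using star_automorphism_action[of s] by (auto simp: star_automorphism_def)

lemma action_zero: "action \<sigma> s 0 = 0"
  using action_add[of s 0 0] by simp

lemma action_1: "action \<sigma> 1 a = a"
  by (simp add: action_def one_free_group.rep_eq)

lemma action_mult: "action \<sigma> (s * t) a = action \<sigma> s (action \<sigma> t a)"
proof -
  \<comment> \<open>When \<open>push\<close> cancels a letter, the two actions involved are inverse
    to each other.\<close>
  have push: "foldr (letter_action \<sigma>) (push x w) a = letter_action \<sigma> x (foldr (letter_action \<sigma>) w a)"
    for x w by (cases w) (auto simp: letter_action_flip)
  have "foldr (letter_action \<sigma>) (foldr push u v) a =
      foldr (letter_action \<sigma>) u (foldr (letter_action \<sigma>) v a)" for u v
    by (induction u) (auto simp: push)
  then show ?thesis by (simp add: action_def times_free_group.rep_eq)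
qed

text \<open>The element \<open>a U\<^sub>s\<close>.\<close>

definition cmono :: "'n free_group \<Rightarrow> 'a \<Rightarrow> 'c" where
  "cmono s a = j (Poly_Mapping.single s a)"

lemma cmono_add: "cmono s (a + b) = cmono s a + cmono s b"
  using j by (simp add: cmono_def full_crossed_product_def Poly_Mapping.single_add)

lemma cmono_zero [simp]: "cmono s 0 = 0"
  using cmono_add[of s 0 0] by simp

lemma cmono_diff: "cmono s (a - b) = cmono s a - cmono s b"
  using cmono_add[of s "a - b" b] by simp

lemma cmono_minus: "cmono s (- a) = - cmono s a"
  using cmono_diff[of s 0 a] by simp

lemma cmono_scaleC: "cmono s (c *\<^sub>C a) = c *\<^sub>C cmono s a"
proof -
  have "conv_scale c (Poly_Mapping.single s a) = Poly_Mapping.single s (c *\<^sub>C a)"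
    by (simp add: conv_scale_def)
  then show ?thesis using j unfolding cmono_def full_crossed_product_def by metis
qed

lemma cmono_mult: "cmono s a * cmono t b = cmono (s * t) (a * action \<sigma> s b)"
proof -
  have "conv_mult \<sigma> (Poly_Mapping.single s a) (Poly_Mapping.single t b) =
      Poly_Mapping.single (s * t) (a * action \<sigma> s b)"
    by (simp add: conv_mult_def action_zero)
  then show ?thesis using j unfolding cmono_def full_crossed_product_def by metis
qed

lemma cmono_adj: "adj (cmono s a) = cmono (free_inv s) (action \<sigma> (free_inv s) (adj a))"
proof -
  have "conv_adj \<sigma> (Poly_Mapping.single s a) =
      Poly_Mapping.single (free_inv s) (action \<sigma> (free_inv s) (adj a))"
    by (simp add: conv_adj_def action_zero)
  then show ?thesis using j unfolding cmono_def full_crossed_product_def by metis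
qed

lemma cmono_mult_adj:
  "cmono t a * adj (cmono r b) = cmono (t * free_inv r) (a * action \<sigma> (t * free_inv r) (adj b))"
  by (simp add: cmono_adj cmono_mult action_mult)

lemma range_cmono_1: "complex_subalgebra (range (cmono 1))"
  unfolding complex_subalgebra_def
proof (intro conjI ballI allI)
  show "0 \<in> range (cmono 1)"
    using rangeI[of "cmono 1" 0] by simp
qed (auto simp: cmono_add[symmetric] cmono_scaleC[symmetric] cmono_mult)

lemma adj_cmono_1: "adj (cmono 1 a) = cmono 1 (adj a)"
  using free_inv_right[of "1 :: 'n free_group"] by (simp add: cmono_adj action_1)

abbreviation generators :: "'c set" where
  "generators \<equiv> range (\<lambda>a. j (Poly_Mapping.single 1 a)) \<union>
      range (\<lambda>(i, a). j (Poly_Mapping.single (gen i) (inv_into UNIV (\<sigma> i) a)))"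

text \<open>Since each \<open>\<sigma> i\<close> is bijective, the twisted coefficients run through
  the whole coefficient algebra.\<close>

lemma generators_eq: "generators = range (cmono 1) \<union> (\<Union>i. range (cmono (gen i)))"
proof -
  have "surj (inv_into UNIV (\<sigma> i))" for i
    using star_automorphism_inv[OF \<sigma>[of i]] by (simp add: star_automorphism_def bij_is_surj)
  then have "range (cmono (gen i)) = range (\<lambda>a. cmono (gen i) (inv_into UNIV (\<sigma> i) a))" for i
    by (metis image_image)
  moreover have "range (\<lambda>(i, a). j (Poly_Mapping.single (gen i) (inv_into UNIV (\<sigma> i) a))) =
      (\<Union>i. range (\<lambda>a. cmono (gen i) (inv_into UNIV (\<sigma> i) a)))"
    unfolding cmono_def by force
  moreover have "range (\<lambda>a. j (Poly_Mapping.single 1 a)) = range (cmono 1)"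
    unfolding cmono_def by simp
  ultimately show ?thesis by simp
qed

definition algebraic :: "'c set" where
  "algebraic = subalgebra_generated generators"

lemma algebraic: "complex_subalgebra algebraic"
  by (simp add: algebraic_def subalgebra_generated)

lemma cmono_algebraic: "cmono 1 a \<in> algebraic" "cmono (gen i) a \<in> algebraic"
  using subalgebra_generated_superset[of generators]
  unfolding algebraic_def[symmetric] unfolding generators_eq by blast+

end

locale crossed_product_rep = crossed_product \<sigma> j + matrix_rep k \<rho>
  for \<sigma> :: "'n \<Rightarrow> 'a::cstar_algebra \<Rightarrow> 'a"
    and j :: "('n, 'a) conv \<Rightarrow> 'c::cstar_algebra"
    and k and \<rho> :: "'c \<Rightarrow> complex mat"
begin

text \<open>Multiplication by the unitary \<open>U\<^sub>s\<close> on the right does not change \<open>x x\<^sup>*\<close>, so it respects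
  membership in \<open>J\<close>.\<close>

lemma cmono_shift:
  "(\<Sum>i\<in>I. cmono (t i * s) (a i)) \<in> J \<longleftrightarrow> (\<Sum>i\<in>I. cmono (t i) (a i)) \<in> J"
proof -
  have J_iff: "x \<in> J \<longleftrightarrow> x * adj x \<in> J" for x
    using J_adj_multD[of "adj x"] J_mult_right by (auto simp: adj_adj J_adj_iff)
  have "(\<Sum>i\<in>I. cmono (t i * s) (a i)) * adj (\<Sum>i\<in>I. cmono (t i * s) (a i)) =
      (\<Sum>i\<in>I. cmono (t i) (a i)) * adj (\<Sum>i\<in>I. cmono (t i) (a i))"
    by (simp add: adj_sum sum_product cmono_mult_adj mult_free_inv_cancel_right)
  then show ?thesis
    by (subst (1 2) J_iff) simp
qed

lemma cmono_J: "cmono 1 a \<in> J \<Longrightarrow> cmono s a \<in> J"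
  using cmono_shift[of "\<lambda>_. 1" s "\<lambda>_. a" "{()}"] by simp

text \<open>The sum of \<open>algebraic\<close> and \<open>J\<close>. It turns closure under
  adjoints modulo \<open>J\<close> into plain membership of the adjoint.\<close>

definition N :: "'c set" where
  "N = {x. \<exists>b\<in>algebraic. b - x \<in> J}"

lemma N: "complex_subalgebra N"
proof -
  have alg: "0 \<in> algebraic" "\<And>x y. x \<in> algebraic \<Longrightarrow> y \<in> algebraic \<Longrightarrow> x + y \<in> algebraic"
    "\<And>c x. x \<in> algebraic \<Longrightarrow> c *\<^sub>C x \<in> algebraic"
    "\<And>x y. x \<in> algebraic \<Longrightarrow> y \<in> algebraic \<Longrightarrow> x * y \<in> algebraic"
    using algebraic by (auto simp: complex_subalgebra_def)
  have N_eq: "N = {x. \<exists>b\<in>algebraic. \<rho> b = \<rho> x}"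
    by (simp add: N_def J_diff_iff)
  show ?thesis
    unfolding complex_subalgebra_def N_eq
  proof (intro conjI ballI allI)
    fix x y c assume "x \<in> {x. \<exists>b\<in>algebraic. \<rho> b = \<rho> x}" "y \<in> {x. \<exists>b\<in>algebraic. \<rho> b = \<rho> x}"
    then obtain b d where "b \<in> algebraic" "\<rho> b = \<rho> x" "d \<in> algebraic" "\<rho> d = \<rho> y"
      by auto
    then have "b + d \<in> algebraic \<and> \<rho> (b + d) = \<rho> (x + y)"
      and "b * d \<in> algebraic \<and> \<rho> (b * d) = \<rho> (x * y)"
      and "c *\<^sub>C b \<in> algebraic \<and> \<rho> (c *\<^sub>C b) = \<rho> (c *\<^sub>C x)"
      using alg by (simp_all add: rep_add rep_mult rep_scaleC)
    then show "x + y \<in> {x. \<exists>b\<in>algebraic. \<rho> b = \<rho> x}" "x * y \<in> {x. \<exists>b\<in>algebraic. \<rho> b = \<rho> x}"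
      "c *\<^sub>C x \<in> {x. \<exists>b\<in>algebraic. \<rho> b = \<rho> x}"
      by blast+
  qed (use alg(1) in blast)
qed

lemma algebraic_N: "algebraic \<subseteq> N"
  unfolding N_def J_diff_iff by blast

lemma N_cong: "x \<in> N \<Longrightarrow> x - y \<in> J \<Longrightarrow> y \<in> N"
  unfolding N_def J_diff_iff by auto

lemma N_add: "x \<in> N \<Longrightarrow> y \<in> N \<Longrightarrow> x + y \<in> N"
  and N_scaleC: "x \<in> N \<Longrightarrow> c *\<^sub>C x \<in> N"
  and N_mult: "x \<in> N \<Longrightarrow> y \<in> N \<Longrightarrow> x * y \<in> N"
  using N by (auto simp: complex_subalgebra_def)

text \<open>An idempotent \<open>c\<close> gives the factorization \<open>c U\<^sup>m\<^sup>+\<^sup>1 = (c U) (\<alpha>\<^sup>-\<^sup>1(c) U\<^sup>m)\<close> modulo \<open>J\<close>, and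
  idempotents span the image of the coefficient algebra.\<close>

lemma cmono_power_N: "cmono (gen i ^ m) a \<in> N"
proof (induction m arbitrary: a)
  case 0
  then show ?case using cmono_algebraic algebraic_N by auto
next
  case (Suc m)
  define s where "s = gen i ^ Suc m"
  \<comment> \<open>The induction runs over elements \<open>cmono 1 a\<close>, so the property must
    quantify over a coefficient \<open>b\<close> representing them. By \<open>cmono_J\<close>,
    coefficients with the same image give the same monomial at \<open>s\<close> modulo
    \<open>J\<close>.\<close>
  have "\<exists>b. cmono 1 a = cmono 1 b \<and> cmono s b \<in> N"
  proof (rule idempotent_induct[OF range_cmono_1, where a = "cmono 1 a"])
    show "\<forall>b\<in>range (cmono 1). \<exists>b'\<in>range (cmono 1). b' - adj b \<in> J"
    proof
      fix b assume "b \<in> range (cmono 1)"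
      then have "adj b \<in> range (cmono 1)"
        by (auto simp: adj_cmono_1)
      then show "\<exists>b'\<in>range (cmono 1). b' - adj b \<in> J"
        by (intro bexI[of _ "adj b"]) simp_all
    qed
  next
    fix x y assume "\<exists>b. x = cmono 1 b \<and> cmono s b \<in> N" "\<exists>b. y = cmono 1 b \<and> cmono s b \<in> N"
    then show "\<exists>b. x + y = cmono 1 b \<and> cmono s b \<in> N"
      by (metis N_add cmono_add)
  next
    fix c x assume "\<exists>b. x = cmono 1 b \<and> cmono s b \<in> N"
    then show "\<exists>b. c *\<^sub>C x = cmono 1 b \<and> cmono s b \<in> N"
      by (metis N_scaleC cmono_scaleC)
  next
    fix x y assume "y \<in> range (cmono 1)" "x - y \<in> J" "\<exists>b. x = cmono 1 b \<and> cmono s b \<in> N"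
    then obtain b d where "x = cmono 1 b" "cmono s b \<in> N" "y = cmono 1 d" "cmono 1 (b - d) \<in> J"
      by (auto simp: cmono_diff)
    then show "\<exists>b. y = cmono 1 b \<and> cmono s b \<in> N"
      using cmono_J[of "b - d" s] N_cong[of "cmono s b" "cmono s d"] by (auto simp: cmono_diff)
  next
    fix p assume "p \<in> range (cmono 1)" "p * p - p \<in> J"
    then obtain c where c: "p = cmono 1 c" "cmono 1 (c * c - c) \<in> J"
      by (auto simp: cmono_diff cmono_mult action_1)
    define d where "d = action \<sigma> (free_inv (gen i)) c"
    have "action \<sigma> (gen i) d = c"
      by (simp add: d_def action_mult[symmetric] free_inv_right action_1)
    then have "cmono (gen i) c * cmono (gen i ^ m) d = cmono s (c * c)"
      by (simp add: cmono_mult s_def)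
    moreover have "cmono (gen i) c * cmono (gen i ^ m) d \<in> N"
      using cmono_algebraic(2) algebraic_N by (intro N_mult Suc.IH) auto
    ultimately have "cmono s c \<in> N"
      using cmono_J[OF c(2), of s] N_cong by (simp add: cmono_diff)
    then show "\<exists>b. p = cmono 1 b \<and> cmono s b \<in> N"
      using c(1) by blast
  qed simp
  then obtain b where b: "cmono 1 a = cmono 1 b" "cmono s b \<in> N"
    by blast
  then have "cmono 1 (b - a) \<in> J"
    by (simp add: cmono_diff)
  with b(2) show ?case
    using cmono_J[of "b - a" s] N_cong[of "cmono s b" "cmono s a"] by (simp add: cmono_diff s_def)
qed

text \<open>A linear relation among the \<open>\<rho> (a U\<^sup>m)\<close>, \<open>m \<ge> 0\<close>, can be divided by the lowest power of \<open>U\<close>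
  in it and once more by \<open>U\<close>.\<close>

lemma cmono_inverse_N: "cmono (free_inv (gen i)) a \<in> N"
proof -
  define g where "g = gen i"
  obtain m d c where rec: "cmono (g ^ m) a - (\<Sum>l<d. c l *\<^sub>C cmono (g ^ Suc (m + l)) a) \<in> J"
    using linear_recurrence[of "\<lambda>m. cmono (g ^ m) a"] by blast
  \<comment> \<open>The exponents -1, 0, ..., \<open>d - 1\<close> with the coefficients of the
    relation; shifting by \<open>g ^ Suc m\<close> restores the exponents from \<open>m\<close> to
    \<open>m + d\<close> in \<open>rec\<close>.\<close>
  define t where "t l = (case l of 0 \<Rightarrow> free_inv g | Suc l \<Rightarrow> g ^ l)" for l
  define b where "b l = (case l of 0 \<Rightarrow> a | Suc l \<Rightarrow> (- c l) *\<^sub>C a)" for l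
  have t: "t 0 * g ^ Suc m = g ^ m" "t (Suc l) * g ^ Suc m = g ^ Suc (m + l)" for l
  proof -
    show "t 0 * g ^ Suc m = g ^ m"
      by (simp add: t_def mult.assoc[symmetric] free_inv_left)
    show "t (Suc l) * g ^ Suc m = g ^ Suc (m + l)"
      by (simp add: t_def power_add[symmetric] add.commute del: power_Suc)
  qed
  have "(\<Sum>l<Suc d. cmono (t l * g ^ Suc m) (b l)) \<in> J"
    unfolding sum.lessThan_Suc_shift t
    using rec by (simp add: b_def cmono_minus cmono_scaleC sum_negf del: power_Suc)
  then have "(\<Sum>l<Suc d. cmono (t l) (b l)) \<in> J"
    by (simp only: cmono_shift)
  then have "cmono (free_inv g) a - (\<Sum>l<d. c l *\<^sub>C cmono (g ^ l) a) \<in> J"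
    unfolding sum.lessThan_Suc_shift by (simp add: t_def b_def cmono_minus cmono_scaleC sum_negf)
  then have "(\<Sum>l<d. c l *\<^sub>C cmono (g ^ l) a) - cmono (free_inv g) a \<in> J"
    unfolding J_diff_iff by simp
  moreover have "(\<Sum>l<d. c l *\<^sub>C cmono (g ^ l) a) \<in> N"
    unfolding g_def by (intro complex_subalgebra_sum[OF N] N_scaleC cmono_power_N)
  ultimately show ?thesis
    using N_cong unfolding g_def by blast
qed

text \<open>The elements whose adjoint is in \<open>N\<close> form an algebra, so generators
  suffice; the adjoint of a monomial at \<open>gen i\<close> is one at its inverse, where
  \<open>cmono_inverse_N\<close> applies.\<close>

lemma algebraic_star_closed:
  assumes "b \<in> algebraic"
  shows "\<exists>b'\<in>algebraic. b' - adj b \<in> J"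
proof -
  have "algebraic \<subseteq> {b. adj b \<in> N}"
    unfolding algebraic_def
  proof (rule subalgebra_generated_least)
    show "complex_subalgebra {b. adj b \<in> N}"
      using N by (auto simp: complex_subalgebra_def adj_add adj_scaleC adj_mult)
    show "generators \<subseteq> {b. adj b \<in> N}"
      unfolding generators_eq
    proof (intro Un_least UN_least image_subsetI CollectI)
      show "adj (cmono 1 a) \<in> N" for a
        using cmono_algebraic(1) algebraic_N by (auto simp: adj_cmono_1)
      show "adj (cmono (gen i) a) \<in> N" for i a
        by (simp add: cmono_adj cmono_inverse_N)
    qed
  qed
  then show ?thesis
    using assms unfolding N_def by auto
qed

sublocale rep_pair k \<rho> "semicrossed_product \<sigma> j" algebraic
proof
  show "complex_subalgebra (semicrossed_product \<sigma> j)"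
    by (simp add: semicrossed_product_def complex_subalgebra_closed_subalgebra_generated)
  show "algebraic \<subseteq> semicrossed_product \<sigma> j" "semicrossed_product \<sigma> j \<subseteq> closure algebraic"
    by (simp_all add: semicrossed_product_def algebraic_def subalgebra_generated_subset_closed
        closed_subalgebra_generated_dense)
qed (auto intro: algebraic algebraic_star_closed)

end

section \<open>Separation of points by finite dimensional representations\<close>

theorem proposition4p13:
  fixes \<sigma> :: "'n::finite \<Rightarrow> 'a::cstar_algebra \<Rightarrow> 'a"
    and j :: "('n, 'a) conv \<Rightarrow> 'c::cstar_algebra"
    and \<delta> :: "'c \<Rightarrow> 'c"
  assumes "\<And>i. star_automorphism (\<sigma> i)"
    and "full_crossed_product \<sigma> j"
    and "residually_finite_dimensional TYPE('c)"
    and "approximately_local_derivation_on (semicrossed_product \<sigma> j) \<delta>"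
  shows "derivation_on (semicrossed_product \<sigma> j) \<delta>"
proof -
  have "\<delta> (x * y) = \<delta> x * y + x * \<delta> y"
    if "x \<in> semicrossed_product \<sigma> j" "y \<in> semicrossed_product \<sigma> j" for x y
  proof (rule ccontr)
    assume "\<not> ?thesis"
    then have "\<delta> (x * y) - \<delta> x * y - x * \<delta> y \<noteq> 0"
      by (simp add: algebra_simps)
    \<comment> \<open>A nonzero defect is detected by one finite dimensional representation, whose
      kernel contains that defect by \<open>defect_J\<close>.\<close>
    then obtain k \<rho> where \<rho>: "matrix_star_rep k (\<rho> :: 'c \<Rightarrow> complex mat)"
      and ne: "\<rho> (\<delta> (x * y) - \<delta> x * y - x * \<delta> y) \<noteq> \<rho> 0"
      using assms(3) unfolding residually_finite_dimensional_def by blast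
    interpret crossed_product_rep \<sigma> j k \<rho>
      by standard (fact assms \<rho>)+
    interpret rep_local_derivation k \<rho> "semicrossed_product \<sigma> j" algebraic \<delta>
      by standard (fact assms)
    show False
      using defect_J[OF that] ne by (simp add: defect_def J_def rep_zero)
  qed
  then show ?thesis
    using assms(4) by (simp add: derivation_on_def approximately_local_derivation_on_def)
qed

end
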